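(* Let $N$ be a finite set and let $f: 2^{N} \to \mathbb{R} \cup \{-\infty\}$ be an M$^\natural$-concave function. Then $f$ has the multiple exchange property: for any $X, Y \subseteq N$ and any $I \subseteq X \setminus Y$, there exists $J \subseteq Y \setminus X$ such that $$f(X) + f(Y) \leq f((X \setminus I) \cup J) + f((Y \setminus J) \cup I).$$
   Context: For $f: 2^N \to \mathbb{R}\cup\{-\infty\}$, $\mathrm{dom}\, f = \{X \subseteq N : f(X) > -\infty\}$. Notation: $X - i = X \setminus \{i\}$, $Y + i = Y \cup \{i\}$, $X - i + j = (X\setminus\{i\})\cup\{j\}$, $Y + i - j = (Y \cup\{i\})\setminus\{j\}$. Conventions: $(-\infty)+a = a+(-\infty) = (-\infty)+(-\infty) = -\infty$ for $a \in \mathbb{R}$, $-\infty \le -\infty$, and a maximum over an empty set is $-\infty$. A function $f: 2^N \to \mathbb{R}\cup\{-\infty\}$ with $\mathrm{dom}\, f \neq \emptyset$ is M$^\natural$-concave if for all $X, Y \subseteq N$ and $i \in X \setminus Y$: $$f(X)+f(Y) \le \max\Big[ f(X-i)+f(Y+i),\ \max_{j \in Y\setminus X}\{ f(X-i+j)+f(Y+i-j)\}\Big].$$ *)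

theory Defs
  imports "HOL-Analysis.Analysis"
begin

text \<open>Functions f : 2^N -> R \<union> {-\<infinity>} are modelled as f :: 'a set => ereal on subsets
  of a ground set N, never taking the value +\<infinity>.  The maximum over an empty set is
  -\<infinity>, which coincides with Sup {} in ereal.\<close>

definition valued_on :: "'a set \<Rightarrow> ('a set \<Rightarrow> ereal) \<Rightarrow> bool" where
  "valued_on N f \<longleftrightarrow> (\<forall>X\<subseteq>N. f X \<noteq> \<infinity>)"

definition dom_fun :: "'a set \<Rightarrow> ('a set \<Rightarrow> ereal) \<Rightarrow> 'a set set" where
  "dom_fun N f = {X. X \<subseteq> N \<and> f X > -\<infinity>}"

definition Mnat_concave :: "'a set \<Rightarrow> ('a set \<Rightarrow> ereal) \<Rightarrow> bool" where
  "Mnat_concave N f \<longleftrightarrow> valued_on N f \<and> dom_fun N f \<noteq> {} \<and>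
     (\<forall>X Y i. X \<subseteq> N \<longrightarrow> Y \<subseteq> N \<longrightarrow> i \<in> X - Y \<longrightarrow>
        f X + f Y \<le> max (f (X - {i}) + f (insert i Y))
                         (Sup ((\<lambda>j. f (insert j (X - {i})) + f (insert i Y - {j})) ` (Y - X))))"

definition multiple_exchange :: "'a set \<Rightarrow> ('a set \<Rightarrow> ereal) \<Rightarrow> bool" where
  "multiple_exchange N f \<longleftrightarrow>
     (\<forall>X Y I. X \<subseteq> N \<longrightarrow> Y \<subseteq> N \<longrightarrow> I \<subseteq> X - Y \<longrightarrow>
        (\<exists>J. J \<subseteq> Y - X \<and> f X + f Y \<le> f ((X - I) \<union> J) + f ((Y - J) \<union> I)))"

end

theory Submission
  imports Defs
begin

text \<open>For \<open>J \<subseteq> Y - X\<close> put \<open>g\<^sub>1 J = f ((X - I) \<union> J)\<close> and \<open>g\<^sub>2 J = f ((Y - J) \<union> I)\<close>; both satisfy the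
exchange property, and the claim is a lower bound on the maximum of \<open>g\<^sub>1 + g\<^sub>2\<close>. For every price
vector on \<open>Y - X\<close>, the projection of the priced \<open>f\<close> to subsets of \<open>X\<close> again satisfies the exchange
property, hence is submodular; this is precisely the bound \<open>f X + f Y\<close> for the Lagrangian dual of
maximising \<open>g\<^sub>1 + g\<^sub>2\<close>. By linear programming duality the bound is met by a fractional
solution: probability weights for \<open>g\<^sub>1\<close> and for \<open>g\<^sub>2\<close> with a common marginal \<open>x\<close>. Among the optimal
fractional solutions choose one that maximises \<open>\<Sum> x\<^sub>e\<^sup>2\<close>. If \<open>x\<close> had fractional entries, exchanges in
the supports would let \<open>x\<close> move both ways along a nonzero direction at constant value, and one of
the two moves would increase \<open>\<Sum> x\<^sub>e\<^sup>2\<close>. So \<open>x\<close> is the indicator of the required \<open>J\<close>.\<close>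

section \<open>The exchange property\<close>

text \<open>\<open>S\<close> is empty or the singleton \<open>{j}\<close>, which merges the two alternatives of the exchange axiom.\<close>
definition exch :: "'a set set \<Rightarrow> ('a set \<Rightarrow> real) \<Rightarrow> bool" where
  "exch D g \<longleftrightarrow> (\<forall>X\<in>D. \<forall>Y\<in>D. \<forall>i\<in>X - Y. \<exists>S j. S \<subseteq> Y - X \<and> S \<subseteq> {j} \<and>
     (X - {i}) \<union> S \<in> D \<and> insert i Y - S \<in> D \<and>
     g X + g Y \<le> g ((X - {i}) \<union> S) + g (insert i Y - S))"

lemma exchE:
  assumes "exch D g" "X \<in> D" "Y \<in> D" "i \<in> X" "i \<notin> Y"
  obtains S j where "S \<subseteq> Y - X" "S \<subseteq> {j}" "(X - {i}) \<union> S \<in> D" "insert i Y - S \<in> D"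
    "g X + g Y \<le> g ((X - {i}) \<union> S) + g (insert i Y - S)"
  using assms unfolding exch_def by (metis DiffI)

text \<open>An exchange only redistributes elements between the two sets, so the indicators of
  \<open>X\<close> and \<open>Y\<close> keep their sum and the prices cancel.\<close>

lemma exch_linear_shift:
  assumes "exch D g"
  shows "exch D (\<lambda>Z. g Z - (\<Sum>e\<in>W. p e * indicator Z e))"
  unfolding exch_def
proof (intro ballI, goal_cases)
  case (1 X Y i)
  then obtain S j where S: "S \<subseteq> Y - X" "S \<subseteq> {j}" "(X - {i}) \<union> S \<in> D" "insert i Y - S \<in> D"
    "g X + g Y \<le> g ((X - {i}) \<union> S) + g (insert i Y - S)"
    using exchE[OF assms, of X Y i] by (metis DiffE)
  have "p e * indicator X e + p e * indicator Y e =
      p e * indicator ((X - {i}) \<union> S) e + p e * indicator (insert i Y - S) e" for e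
    using S 1 by (auto simp: indicator_def)
  then have "(\<Sum>e\<in>W. p e * indicator X e) + (\<Sum>e\<in>W. p e * indicator Y e) =
      (\<Sum>e\<in>W. p e * indicator ((X - {i}) \<union> S) e) + (\<Sum>e\<in>W. p e * indicator (insert i Y - S) e)"
    by (simp flip: sum.distrib)
  with S show ?case
    by (intro exI[of _ S] exI[of _ j]) auto
qed

section \<open>Projection, submodularity, and exchange with two different sets\<close>

lemma Max_fibre_attained:
  fixes g :: "'b \<Rightarrow> 'c :: linorder"
  assumes "finite D" "A \<in> \<pi> ` D"
  obtains Z where "Z \<in> D" "\<pi> Z = A" "g Z = Max (g ` {Z \<in> D. \<pi> Z = A})"
proof -
  have "Max (g ` {Z \<in> D. \<pi> Z = A}) \<in> g ` {Z \<in> D. \<pi> Z = A}"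
    using assms by (intro Max_in) auto
  then obtain Z where "Z \<in> {Z \<in> D. \<pi> Z = A}" "Max (g ` {Z \<in> D. \<pi> Z = A}) = g Z" by (rule imageE)
  with that[of Z] show ?thesis by simp
qed

text \<open>Maximisers over two fibres are exchanged in \<open>D\<close> and then cut down to
  \<open>U\<close>. A partner \<open>j\<close> outside \<open>U\<close> disappears, which turns an
  exchange with partner into one without, so replacing \<open>S\<close> by
  \<open>S \<inter> U\<close> stays within \<open>exch\<close>.\<close>

lemma exch_projection:
  assumes "exch D g" "finite D"
  shows "exch ((\<lambda>Z. Z \<inter> U) ` D) (\<lambda>A. Max (g ` {Z \<in> D. Z \<inter> U = A}))"
  (is "exch ?E ?h")
proof -
  have fin: "finite (g ` {Z \<in> D. Z \<inter> U = A})" for A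
    using assms by auto
  have upper: "g Z \<le> ?h (Z \<inter> U)" if "Z \<in> D" for Z
    using that by (intro Max_ge fin) auto
  show ?thesis
    unfolding exch_def
  proof (intro ballI, goal_cases)
    case (1 A B i)
    obtain P where P: "P \<in> D" "P \<inter> U = A" "g P = ?h A"
      by (rule Max_fibre_attained[OF assms(2) 1(1), where g = g]) (rule that)
    obtain Q where Q: "Q \<in> D" "Q \<inter> U = B" "g Q = ?h B"
      by (rule Max_fibre_attained[OF assms(2) 1(2), where g = g]) (rule that)
    have i: "i \<in> U" "i \<in> P" "i \<notin> Q" using 1(3) P(2) Q(2) by auto
    obtain S j where S: "S \<subseteq> Q - P" "S \<subseteq> {j}" "(P - {i}) \<union> S \<in> D" "insert i Q - S \<in> D"
      "g P + g Q \<le> g ((P - {i}) \<union> S) + g (insert i Q - S)"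
      by (rule exchE[OF assms(1) P(1) Q(1) i(2,3)]) (rule that)
    have 1: "((P - {i}) \<union> S) \<inter> U = (A - {i}) \<union> (S \<inter> U)"
      and 2: "(insert i Q - S) \<inter> U = insert i B - (S \<inter> U)"
      using P(2) Q(2) i by auto
    have "?h A + ?h B \<le> ?h ((A - {i}) \<union> (S \<inter> U)) + ?h (insert i B - (S \<inter> U))"
      using upper[OF S(3)] upper[OF S(4)] S(5) P(3) Q(3) unfolding 1 2 by linarith
    moreover have "(A - {i}) \<union> (S \<inter> U) \<in> ?E" "insert i B - (S \<inter> U) \<in> ?E"
      using imageI[OF S(3), of "\<lambda>Z. Z \<inter> U"] imageI[OF S(4), of "\<lambda>Z. Z \<inter> U"]
      unfolding 1 2 .
    moreover have "S \<inter> U \<subseteq> B - A" "S \<inter> U \<subseteq> {j}"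
      using S(1,2) P(2) Q(2) by auto
    ultimately show ?case by (intro exI[of _ "S \<inter> U"] exI[of _ j] conjI)
  qed
qed

text \<open>Between nested sets no element can be given back, so an exchange is a pure transfer from
  the larger set to the smaller one. Treating the elements of \<open>A - B\<close> one at a time
  gives submodularity.\<close>

lemma exch_submodular:
  assumes "exch D g" "finite (A - B)" "A \<union> B \<in> D" "A \<inter> B \<in> D"
  shows "A \<in> D \<and> B \<in> D \<and> g (A \<union> B) + g (A \<inter> B) \<le> g A + g B"
  using assms(2-4)
proof (induction "card (A - B)" arbitrary: A B)
  case 0
  then have "A \<subseteq> B" by auto
  then show ?case using 0 by (simp add: Un_absorb1 Int_absorb2)
next
  case (Suc n)
  then obtain i where i: "i \<in> A" "i \<notin> B" by (metis DiffE card.empty ex_in_conv nat.distinct(1))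
  \<comment> \<open>This exchange puts \<open>A \<union> B - {i}\<close> into \<open>D\<close>, as
    the induction hypothesis for \<open>A - {i}\<close> and \<open>B\<close> requires.\<close>
  obtain S j where S: "S \<subseteq> (A \<inter> B) - (A \<union> B)" "((A \<union> B) - {i}) \<union> S \<in> D" "insert i (A \<inter> B) - S \<in> D"
    "g (A \<union> B) + g (A \<inter> B) \<le> g (((A \<union> B) - {i}) \<union> S) + g (insert i (A \<inter> B) - S)"
    using exchE[OF assms(1) Suc.prems(2,3)] i by (metis IntD2 UnI1)
  then have "S = {}" by auto
  with S have S': "A \<union> B - {i} \<in> D" "insert i (A \<inter> B) \<in> D"
    "g (A \<union> B) + g (A \<inter> B) \<le> g (A \<union> B - {i}) + g (insert i (A \<inter> B))" by auto
  have eq: "(A - {i}) \<union> B = A \<union> B - {i}" "(A - {i}) \<inter> B = A \<inter> B"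
    "A - {i} - B = A - B - {i}" using i by auto
  have c: "n = card (A - {i} - B)"
    unfolding eq using Suc(2) i by (metis DiffI card_Diff_singleton diff_Suc_1)
  have 1: "A - {i} \<in> D \<and> B \<in> D \<and> g (A \<union> B - {i}) + g (A \<inter> B) \<le> g (A - {i}) + g B"
    using Suc(1)[OF c] S' Suc.prems unfolding eq by auto
  \<comment> \<open>A second nested pair; adding its inequality to that of the induction hypothesis
    cancels \<open>g (A \<union> B - {i})\<close> and \<open>g (A - {i})\<close>.\<close>
  obtain T where T: "T \<subseteq> (A - {i}) - (A \<union> B)" "((A \<union> B) - {i}) \<union> T \<in> D"
    "insert i (A - {i}) - T \<in> D"
    "g (A \<union> B) + g (A - {i}) \<le> g (((A \<union> B) - {i}) \<union> T) + g (insert i (A - {i}) - T)"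
    using exchE[OF assms(1) Suc.prems(2), of "A - {i}" i] 1 i by (metis Diff_iff UnI1 singletonI)
  then have "T = {}" by auto
  with T i have "A \<in> D \<and> g (A \<union> B) + g (A - {i}) \<le> g A + g (A \<union> B - {i})"
    by (simp add: insert_absorb add.commute)
  with 1 show ?case by linarith
qed

text \<open>A relaxation of multiple exchange in which the two new sets may use different
  \<open>J\<close> and \<open>K\<close>. It is submodularity of the projection of \<open>g\<close>
  to subsets of \<open>X\<close>, lifted back to \<open>D\<close> by maximisers over the
  fibres.\<close>

lemma exch_partition_exchange:
  assumes "exch D g" "finite D" "D \<subseteq> Pow (X \<union> Y)" "X \<in> D" "Y \<in> D" "I \<subseteq> X - Y" "finite I"
  shows "\<exists>J K. J \<subseteq> Y - X \<and> K \<subseteq> Y - X \<and> (X - I) \<union> J \<in> D \<and> (Y - K) \<union> I \<in> D \<and>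
    g X + g Y \<le> g ((X - I) \<union> J) + g ((Y - K) \<union> I)"
proof -
  let ?E = "(\<lambda>Z. Z \<inter> X) ` D"
  let ?h = "\<lambda>A. Max (g ` {Z \<in> D. Z \<inter> X = A})"
  have fin: "finite (g ` {Z \<in> D. Z \<inter> X = A})" for A
    using assms by auto
  \<comment> \<open>The traces on \<open>X\<close> of the two sets sought: their union is
    \<open>X\<close>, and their intersection is the trace of \<open>Y\<close>.\<close>
  let ?A = "(X \<inter> Y) \<union> I" and ?B = "X - I"
  have eq: "?A \<union> ?B = X \<inter> X" "?A \<inter> ?B = Y \<inter> X" using assms(6) by blast+
  have "finite (?A - ?B)" using assms(6,7) by (auto intro: finite_subset[of _ I])
  moreover have "?A \<union> ?B \<in> ?E" "?A \<inter> ?B \<in> ?E"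
    unfolding eq by (rule imageI, fact)+
  ultimately have sub: "?A \<in> ?E \<and> ?B \<in> ?E \<and> ?h (?A \<union> ?B) + ?h (?A \<inter> ?B) \<le> ?h ?A + ?h ?B"
    by (rule exch_submodular[OF exch_projection[OF assms(1,2)]])
  obtain P where P: "P \<in> D" "P \<inter> X = ?A" "g P = ?h ?A"
    by (rule Max_fibre_attained[OF assms(2) conjunct1[OF sub], where g = g]) (rule that)
  obtain Q where Q: "Q \<in> D" "Q \<inter> X = ?B" "g Q = ?h ?B"
    by (rule Max_fibre_attained[OF assms(2) conjunct1[OF conjunct2[OF sub]], where g = g]) (rule that)
  have "g X \<le> ?h (X \<inter> X)" "g Y \<le> ?h (Y \<inter> X)"
    using assms(4,5) by (auto intro!: Max_ge fin)
  then have "g X + g Y \<le> g Q + g P"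
    using conjunct2[OF conjunct2[OF sub]] P(3) Q(3) unfolding eq by linarith
  \<comment> \<open>\<open>J\<close> is the part of \<open>Q\<close> outside \<open>X\<close>, and
    \<open>K\<close> is the part of \<open>Y - X\<close> that \<open>P\<close> misses.\<close>
  moreover have Q': "(X - I) \<union> (Q - X) = Q" using Q(2) by blast
  moreover have P': "(Y - (Y - X - P)) \<union> I = P"
  proof (rule set_eqI)
    fix x show "x \<in> (Y - (Y - X - P)) \<union> I \<longleftrightarrow> x \<in> P"
      using assms(6) subsetD[OF assms(3) P(1)] P(2) by (cases "x \<in> X") auto
  qed
  moreover have "Q - X \<subseteq> Y - X" using subsetD[OF assms(3) Q(1)] by auto
  ultimately show ?thesis using P(1) Q(1)
    by (intro exI[of _ "Q - X"] exI[of _ "Y - X - P"]) (simp only: Q' P', simp)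
qed

section \<open>Probability weights and linear programming duality\<close>

text \<open>The value 0 is prescribed off \<open>D\<close> so that, for finite \<open>D\<close>, the
  set is compact in the product topology of the whole function type.\<close>

definition prob_weights :: "'b set \<Rightarrow> ('b \<Rightarrow> real) set" where
  "prob_weights D = {l. (\<forall>x. 0 \<le> l x) \<and> (\<forall>x. x \<notin> D \<longrightarrow> l x = 0) \<and> sum l D = 1}"

text \<open>For \<open>h\<close> the map \<open>\<lambda>Z. indicator Z e\<close> this is the
  marginal at \<open>e\<close>, a coordinate of the fractional point represented by
  \<open>l\<close>.\<close>

definition mean :: "'b set \<Rightarrow> ('b \<Rightarrow> real) \<Rightarrow> ('b \<Rightarrow> real) \<Rightarrow> real" where
  "mean D l h = (\<Sum>x\<in>D. l x * h x)"

lemma mean_mix: "mean D (\<lambda>x. u * l x + v * m x) h = u * mean D l h + v * mean D m h"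
  unfolding mean_def by (simp add: sum.distrib sum_distrib_left algebra_simps)

lemma prob_weights_mix:
  assumes "l \<in> prob_weights D" "m \<in> prob_weights D" "0 \<le> t" "t \<le> 1"
  shows "(\<lambda>x. (1 - t) * l x + t * m x) \<in> prob_weights D"
  using assms unfolding prob_weights_def by (auto simp: sum.distrib simp flip: sum_distrib_left)

lemma prob_weights_point: "finite D \<Longrightarrow> z \<in> D \<Longrightarrow> (\<lambda>x. of_bool (x = z)) \<in> prob_weights D"
  unfolding prob_weights_def by auto

lemma mean_point: "finite D \<Longrightarrow> z \<in> D \<Longrightarrow> mean D (\<lambda>x. of_bool (x = z)) h = h z"
  unfolding mean_def by (subst sum.remove[of _ z]) auto

lemma continuous_on_mean: "finite D \<Longrightarrow> continuous_on UNIV (\<lambda>l. mean D l h)"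
  unfolding mean_def by (intro continuous_intros continuous_on_product_coordinates)

text \<open>A closed hyperplane section of a product of unit intervals and singletons, which is
  compact by Tychonoff.\<close>

lemma compact_prob_weights:
  assumes "finite D"
  shows "compact (prob_weights D)"
proof -
  let ?B = "\<lambda>x. if x \<in> D then {0..1::real} else {0}"
  have "compactin (product_topology (\<lambda>_. euclidean) UNIV) (PiE UNIV ?B)"
    by (subst compactin_PiE) auto
  then have "compact (PiE UNIV ?B)"
    by (simp add: euclidean_product_topology)
  moreover have "closed {l :: 'a \<Rightarrow> real. (\<Sum>x\<in>D. l x) = 1}"
    by (intro closed_Collect_eq continuous_intros continuous_on_product_coordinates)
  ultimately have "compact (PiE UNIV ?B \<inter> {l. (\<Sum>x\<in>D. l x) = 1})"
    by (rule compact_Int_closed)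
  also have "PiE UNIV ?B \<inter> {l. (\<Sum>x\<in>D. l x) = 1} = prob_weights D"
  proof -
    have "l x \<le> 1" if "l \<in> prob_weights D" "x \<in> D" for l x
      using that member_le_sum[of x D l] assms by (auto simp: prob_weights_def)
    then show ?thesis
      by (auto simp: prob_weights_def PiE_iff split: if_splits) (metis order.refl zero_le_one)+
  qed
  finally show ?thesis .
qed

text \<open>Dividing by \<open>t\<close> and letting \<open>t\<close> tend to 0 leaves the linear
  coefficient. This yields first-order optimality conditions along a segment.\<close>

lemma quadratic_first_order:
  fixes b q :: real
  assumes "\<And>t. 0 < t \<Longrightarrow> t \<le> 1 \<Longrightarrow> 0 \<le> 2 * t * b + t\<^sup>2 * q"
  shows "0 \<le> b"
proof (rule ccontr)
  assume "\<not> 0 \<le> b"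
  \<comment> \<open>Small enough that \<open>t * q \<le> - b\<close>, hence
    \<open>2 * b + t * q \<le> b\<close>; the added 1 keeps the denominator positive.\<close>
  define t where "t = min 1 (- b / (\<bar>q\<bar> + 1))"
  have t: "0 < t" "t \<le> 1" using \<open>\<not> 0 \<le> b\<close> by (auto simp: t_def intro!: divide_neg_pos)
  have "t \<le> - b / (\<bar>q\<bar> + 1)" by (simp add: t_def)
  then have "t * (\<bar>q\<bar> + 1) \<le> - b" by (subst (asm) pos_le_divide_eq) auto
  moreover have "t * q \<le> t * (\<bar>q\<bar> + 1)" using t by (intro mult_left_mono) auto
  ultimately have "2 * b + t * q < 0" using \<open>\<not> 0 \<le> b\<close> by linarith
  then have "t * (2 * b + t * q) < 0" using t by (simp add: mult_pos_neg)
  then show False using assms[OF t] by (simp add: power2_eq_square algebra_simps)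
qed

text \<open>The weights are taken to minimise the squared violation of the constraints; were it positive,
the residual would yield prices \<open>p\<close> contradicting the hypothesis.\<close>
lemma lp_duality:
  assumes "finite S" "S \<noteq> {}" "finite W"
    and dual: "\<And>p. \<exists>i\<in>S. c \<le> a i + (\<Sum>e\<in>W. p e * v i e)"
  shows "\<exists>l\<in>prob_weights S. (\<forall>e\<in>W. mean S l (\<lambda>i. v i e) = 0) \<and> c \<le> mean S l a"
proof -
  \<comment> \<open>The shortfall below \<open>c\<close> is cut off at 0, so exceeding
    \<open>c\<close> costs nothing.\<close>
  define \<Phi> where "\<Phi> l = (\<Sum>e\<in>W. (mean S l (\<lambda>i. v i e))\<^sup>2) + (max 0 (c - mean S l a))\<^sup>2" for l
  have "continuous_on UNIV \<Phi>"
    unfolding \<Phi>_def by (intro continuous_intros continuous_on_mean assms)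
  then have "continuous_on (prob_weights S) \<Phi>" by (rule continuous_on_subset) simp
  moreover have "prob_weights S \<noteq> {}" using prob_weights_point[OF assms(1)] assms(2) by blast
  ultimately obtain l where l: "l \<in> prob_weights S" and min: "\<And>m. m \<in> prob_weights S \<Longrightarrow> \<Phi> l \<le> \<Phi> m"
    using continuous_attains_inf[OF compact_prob_weights[OF assms(1)]] by metis
  define r where "r e = mean S l (\<lambda>i. v i e)" for e
  define A where "A = mean S l a"
  define \<beta> where "\<beta> = max 0 (c - A)"
  \<comment> \<open>Optimality of \<open>l\<close> against moving it towards the point mass at
    \<open>i\<close>.\<close>
  have first_order: "(\<Sum>e\<in>W. r e * r e) - \<beta> * A \<le> (\<Sum>e\<in>W. r e * v i e) - \<beta> * a i" if "i \<in> S" for i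
  proof -
    define b where "b = (\<Sum>e\<in>W. r e * (v i e - r e)) - \<beta> * (a i - A)"
    have "0 \<le> b"
    proof (rule quadratic_first_order)
      fix t :: real assume t: "0 < t" "t \<le> 1"
      let ?m = "\<lambda>x. (1 - t) * l x + t * of_bool (x = i)"
      have R: "mean S ?m h = mean S l h + t * (h i - mean S l h)" for h
        unfolding mean_mix mean_point[OF assms(1) that] by (simp add: algebra_simps)
      \<comment> \<open>The cut-off square need not be polynomial in \<open>t\<close>; this
        quadratic dominates it and agrees with it at \<open>t = 0\<close>.\<close>
      have "(max 0 (c - A - t * (a i - A)))\<^sup>2 \<le> (\<beta> - t * (a i - A))\<^sup>2"
        by (subst abs_le_square_iff[symmetric]) (auto simp: \<beta>_def)
      moreover have "?m \<in> prob_weights S"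
        using t by (intro prob_weights_mix l prob_weights_point assms that) auto
      ultimately have "(\<Sum>e\<in>W. (r e)\<^sup>2) + \<beta>\<^sup>2 \<le>
          (\<Sum>e\<in>W. (r e + t * (v i e - r e))\<^sup>2) + (\<beta> - t * (a i - A))\<^sup>2"
        using min[of ?m] by (simp add: \<Phi>_def R r_def[symmetric] A_def[symmetric] \<beta>_def[symmetric] diff_diff_eq)
      also have "(\<Sum>e\<in>W. (r e + t * (v i e - r e))\<^sup>2) = (\<Sum>e\<in>W. (r e)\<^sup>2) +
          2 * t * (\<Sum>e\<in>W. r e * (v i e - r e)) + t\<^sup>2 * (\<Sum>e\<in>W. (v i e - r e)\<^sup>2)"
        by (simp add: sum_distrib_left power2_eq_square algebra_simps flip: sum.distrib)
      finally show "0 \<le> 2 * t * b + t\<^sup>2 * ((\<Sum>e\<in>W. (v i e - r e)\<^sup>2) + (a i - A)\<^sup>2)"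
        by (simp add: b_def power2_eq_square algebra_simps)
    qed
    then show ?thesis
      by (simp add: b_def right_diff_distrib sum_subtractf)
  qed
  define \<rho> where "\<rho> = (\<Sum>e\<in>W. r e * r e)"
  have "0 \<le> \<rho>" unfolding \<rho>_def by (intro sum_nonneg) auto
  have "\<beta> = 0"
  proof (rule ccontr)
    assume "\<beta> \<noteq> 0"
    then have \<beta>: "0 < \<beta>" "A = c - \<beta>" by (auto simp: \<beta>_def max_def split: if_splits)
    \<comment> \<open>Under the prices \<open>- (r e / \<beta>)\<close> the first-order condition
      bounds the value of every index by \<open>A - \<rho> / \<beta>\<close>, which is below
      \<open>c\<close>.\<close>
    obtain i where i: "i \<in> S" "c \<le> a i + (\<Sum>e\<in>W. - (r e / \<beta>) * v i e)"
      using dual[of "\<lambda>e. - (r e / \<beta>)"] by auto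
    have "(\<Sum>e\<in>W. - (r e / \<beta>) * v i e) = - (\<Sum>e\<in>W. r e * v i e) / \<beta>"
      by (simp add: sum_negf sum_divide_distrib)
    with i(2) have "c \<le> a i - (\<Sum>e\<in>W. r e * v i e) / \<beta>" by simp
    then have "\<beta> * c \<le> \<beta> * (a i - (\<Sum>e\<in>W. r e * v i e) / \<beta>)"
      using \<beta>(1) by (intro mult_left_mono) auto
    also have "\<dots> = \<beta> * a i - (\<Sum>e\<in>W. r e * v i e)"
      using \<beta>(1) by (simp add: right_diff_distrib)
    also have "\<dots> \<le> \<beta> * (c - \<beta>) - \<rho>"
      using first_order[OF i(1)] unfolding \<rho>_def \<beta>(2)[symmetric] by linarith
    finally have "\<beta> * \<beta> + \<rho> \<le> 0" by (simp add: algebra_simps)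
    with \<open>0 \<le> \<rho>\<close> \<beta> show False by (smt (verit) mult_pos_pos)
  qed
  then have "c \<le> A" by (auto simp: \<beta>_def)
  have "\<rho> = 0"
  proof (rule ccontr)
    assume "\<rho> \<noteq> 0"
    with \<open>0 \<le> \<rho>\<close> have \<rho>: "0 < \<rho>" by simp
    \<comment> \<open>With \<open>\<beta> = 0\<close> the residual \<open>r\<close> has inner
      product at least \<open>\<rho>\<close> with every \<open>v i\<close>, so the prices
      \<open>- (M * r e)\<close> with large \<open>M\<close> push every value below
      \<open>c\<close>.\<close>
    define M where "M = ((\<Sum>i\<in>S. \<bar>a i\<bar>) + \<bar>c\<bar> + 1) / \<rho>"
    have "0 \<le> M" using \<rho> by (auto simp: M_def intro!: divide_nonneg_pos add_nonneg_nonneg sum_nonneg)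
    obtain i where i: "i \<in> S" "c \<le> a i + (\<Sum>e\<in>W. - (M * r e) * v i e)"
      using dual[of "\<lambda>e. - (M * r e)"] by auto
    have "(\<Sum>e\<in>W. - (M * r e) * v i e) = - (M * (\<Sum>e\<in>W. r e * v i e))"
      by (simp add: sum_negf sum_distrib_left mult.assoc)
    moreover have "M * \<rho> \<le> M * (\<Sum>e\<in>W. r e * v i e)"
      using first_order[OF i(1)] \<open>0 \<le> M\<close> \<open>\<beta> = 0\<close> unfolding \<rho>_def by (intro mult_left_mono) auto
    moreover have "M * \<rho> = (\<Sum>i\<in>S. \<bar>a i\<bar>) + \<bar>c\<bar> + 1" using \<rho> by (simp add: M_def)
    moreover have "\<bar>a i\<bar> \<le> (\<Sum>i\<in>S. \<bar>a i\<bar>)" using i(1) assms(1) by (intro member_le_sum) auto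
    ultimately show False using i(2) by linarith
  qed
  then have "\<forall>e\<in>W. r e = 0"
    unfolding \<rho>_def using assms(3) by (subst (asm) sum_nonneg_eq_0_iff) auto
  with l \<open>c \<le> A\<close> show ?thesis unfolding r_def A_def by blast
qed

section \<open>Directions shared by two exchange structures\<close>

text \<open>Gaussian elimination: an equation with a nonzero coefficient at some unknown removes
  that unknown from the others, and back substitution recovers its value.\<close>

lemma underdetermined_system:
  fixes m :: "'c \<Rightarrow> 'a \<Rightarrow> 'k :: field"
  assumes "finite C" "finite F" "card C < card F"
  shows "\<exists>d. (\<forall>e. e \<notin> F \<longrightarrow> d e = 0) \<and> (\<exists>e. d e \<noteq> 0) \<and> (\<forall>c\<in>C. (\<Sum>e\<in>F. m c e * d e) = 0)"
  using assms
proof (induction C arbitrary: F m)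
  case empty
  then obtain e where "e \<in> F" by fastforce
  then show ?case by (intro exI[of _ "\<lambda>x. of_bool (x = e)"]) auto
next
  case (insert c C)
  show ?case
  proof (cases "\<forall>e\<in>F. m c e = 0")
    case True
    then show ?thesis using insert.IH[of F m] insert.prems insert.hyps by auto
  next
    case False
    then obtain e\<^sub>0 where e0: "e\<^sub>0 \<in> F" "m c e\<^sub>0 \<noteq> 0" by blast
    let ?F = "F - {e\<^sub>0}"
    have "card C < card ?F" using insert.prems insert.hyps e0 by auto
    with insert.prems obtain d where d: "\<forall>e. e \<notin> ?F \<longrightarrow> d e = 0" "\<exists>e. d e \<noteq> 0"
      and eq: "\<forall>k\<in>C. (\<Sum>e\<in>?F. (m k e - m k e\<^sub>0 * m c e / m c e\<^sub>0) * d e) = 0"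
      using insert.IH[of ?F "\<lambda>k e. m k e - m k e\<^sub>0 * m c e / m c e\<^sub>0"] by blast
    let ?s = "\<Sum>e\<in>?F. m c e * d e"
    let ?d = "d(e\<^sub>0 := - ?s / m c e\<^sub>0)"
    have sum: "(\<Sum>e\<in>F. m k e * ?d e) = (\<Sum>e\<in>?F. m k e * d e) - m k e\<^sub>0 * ?s / m c e\<^sub>0" for k
    proof -
      have "(\<Sum>e\<in>F. m k e * ?d e) = m k e\<^sub>0 * ?d e\<^sub>0 + (\<Sum>e\<in>?F. m k e * ?d e)"
        using insert.prems e0 by (intro sum.remove)
      also have "(\<Sum>e\<in>?F. m k e * ?d e) = (\<Sum>e\<in>?F. m k e * d e)"
        by (intro sum.cong) auto
      finally show ?thesis by simp
    qed
    have "(\<Sum>e\<in>F. m k e * ?d e) = 0" if "k \<in> insert c C" for k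
    proof (cases "k = c")
      case True
      then show ?thesis unfolding sum using e0 by simp
    next
      case False
      then have "(\<Sum>e\<in>?F. (m k e - m k e\<^sub>0 * m c e / m c e\<^sub>0) * d e) = 0" using eq that by auto
      then show ?thesis unfolding sum
        by (simp add: left_diff_distrib sum_subtractf sum_distrib_left sum_divide_distrib mult.assoc)
    qed
    moreover have "\<exists>e. ?d e \<noteq> 0" using d by (metis Diff_iff fun_upd_other insertI1)
    moreover have "\<forall>e. e \<notin> F \<longrightarrow> ?d e = 0" using d e0 by auto
    ultimately show ?thesis by blast
  qed
qed

text \<open>A linear subspace of functions as a predicate. It will be instantiated by the directions
  in which given weights can move both ways.\<close>

locale function_subspace =
  fixes L :: "('a \<Rightarrow> real) \<Rightarrow> bool"
  assumes zero: "L (\<lambda>_. 0)"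
    and add: "L d \<Longrightarrow> L d' \<Longrightarrow> L (\<lambda>e. d e + d' e)"
    and scale: "L d \<Longrightarrow> L (\<lambda>e. c * d e)"
begin

lemma sum: "(\<And>i. i \<in> F \<Longrightarrow> L (b i)) \<Longrightarrow> L (\<lambda>e. \<Sum>i\<in>F. c i * b i e)"
  by (induction F rule: infinite_finite_induct) (auto intro!: zero add scale)

text \<open>The classes are those of the relation ``the difference of the two unit vectors lies in \<open>L\<close>'',
without the class of the unit vectors in \<open>L\<close>; a partner makes each of them have at least two
elements.\<close>
lemma constraint_classes:
  assumes "finite F"
    and partner: "\<And>i. i \<in> F \<Longrightarrow>
      \<exists>S j. S \<subseteq> {j} \<and> S \<subseteq> F - {i} \<and> L (\<lambda>e. indicator S e - indicator {i} e)"
  obtains C where "finite C" "\<Union>C \<subseteq> F" "pairwise disjnt C" "2 * card C \<le> card F"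
    "2 * card C = card F \<Longrightarrow> \<Union>C = F"
    "\<And>d. (\<forall>e. e \<notin> F \<longrightarrow> d e = 0) \<Longrightarrow> (\<forall>k\<in>C. sum d k = 0) \<Longrightarrow> L d"
proof -
  define r where "r i j \<longleftrightarrow> L (\<lambda>e. indicator {j} e - indicator {i} e)" for i j
  have r_refl: "r i i" for i using zero by (simp add: r_def)
  have r_sym: "r j i" if "r i j" for i j
    using scale[OF that[unfolded r_def], of "-1"] by (simp add: r_def)
  have r_trans: "r i k" if "r i j" "r j k" for i j k
    using add[OF that(1,2)[unfolded r_def]] by (simp add: r_def add.commute)
  define \<kappa> where "\<kappa> i = {j \<in> F. r i j}" for i
  define G where "G = {i \<in> F. \<not> L (indicator {i})}"
  define C where "C = \<kappa> ` G"
  have "finite C" "\<Union>C \<subseteq> F" using assms(1) by (auto simp: C_def G_def \<kappa>_def)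
  have \<kappa>_eq: "\<kappa> i = \<kappa> j" if "r i j" for i j
    unfolding \<kappa>_def using that r_sym r_trans by blast
  have disj: "pairwise disjnt C"
  proof (rule pairwiseI, rule ccontr)
    fix k k' assume *: "k \<in> C" "k' \<in> C" "k \<noteq> k'" "\<not> disjnt k k'"
    then obtain x i j where "k = \<kappa> i" "k' = \<kappa> j" "x \<in> \<kappa> i" "x \<in> \<kappa> j"
      by (auto simp: C_def disjnt_def)
    then have "r i x" "r j x" by (simp_all add: \<kappa>_def)
    then show False using \<kappa>_eq \<open>k = \<kappa> i\<close> \<open>k' = \<kappa> j\<close> *(3) by simp
  qed
  have finC: "finite k" if "k \<in> C" for k using that assms(1) by (auto simp: C_def \<kappa>_def)
  have two: "2 \<le> card k" if k: "k \<in> C" for k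
  proof -
    obtain i where i: "i \<in> F" "\<not> L (indicator {i})" "k = \<kappa> i" using k by (auto simp: C_def G_def)
    obtain S j where S: "S \<subseteq> {j}" "S \<subseteq> F - {i}" "L (\<lambda>e. indicator S e - indicator {i} e)"
      using partner[OF i(1)] by blast
    \<comment> \<open>Without a partner the unit vector of \<open>i\<close> would lie in
      \<open>L\<close>, which \<open>G\<close> excludes. So the partner is a second member of the
      class.\<close>
    have "S \<noteq> {}"
    proof
      assume "S = {}"
      then show False using scale[OF S(3), of "-1"] i(2) by simp
    qed
    with S have "S = {j}" "j \<in> F" "j \<noteq> i" by auto
    moreover from this have "r i j" using S(3) by (simp add: r_def)
    ultimately have "{i, j} \<subseteq> k" "j \<noteq> i" using i r_refl by (simp_all add: \<kappa>_def)
    then show ?thesis using card_mono[OF finC[OF k], of "{i, j}"] by simp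
  qed
  have card: "card (\<Union>C) = (\<Sum>k\<in>C. card k)"
    by (rule card_Union_disjoint[OF disj finC])
  have "2 * card C \<le> card (\<Union>C)"
    unfolding card using sum_bounded_below[of C 2 card] two by (simp add: mult.commute)
  moreover from this have "2 * card C \<le> card F"
    using card_mono[OF assms(1) \<open>\<Union>C \<subseteq> F\<close>] by linarith
  moreover have "2 * card C = card F \<Longrightarrow> \<Union>C = F"
    using card_seteq[OF assms(1) \<open>\<Union>C \<subseteq> F\<close>] \<open>2 * card C \<le> card (\<Union>C)\<close> by linarith
  moreover have "L d" if d: "\<forall>e. e \<notin> F \<longrightarrow> d e = 0" "\<forall>k\<in>C. sum d k = 0" for d
  proof -
    \<comment> \<open>Modulo \<open>L\<close>, each unit vector from \<open>F\<close> equals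
      \<open>b i\<close>: the unit vector of a class representative, or 0 when it lies in
      \<open>L\<close> itself. Replacing unit vectors by \<open>b\<close> collapses \<open>d\<close>
      to its class sums, which vanish, so \<open>d\<close> is in \<open>L\<close>.\<close>
    define \<sigma> where "\<sigma> k = (SOME i. i \<in> k)" for k :: "'a set"
    define b where "b i = (if i \<in> \<Union>C then indicator {\<sigma> (\<kappa> i)} else (\<lambda>_. 0 :: real))" for i
    have L: "L (\<lambda>e. indicator {i} e - b i e)" if "i \<in> F" for i
    proof (cases "i \<in> \<Union>C")
      case True
      have "i \<in> \<kappa> i" using r_refl that by (simp add: \<kappa>_def)
      then have "\<sigma> (\<kappa> i) \<in> \<kappa> i" unfolding \<sigma>_def by (rule someI)
      then have "r i (\<sigma> (\<kappa> i))" by (simp add: \<kappa>_def)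
      then have "r (\<sigma> (\<kappa> i)) i" by (rule r_sym)
      then show ?thesis using True by (simp add: b_def r_def)
    next
      case False
      then have "i \<notin> G" using that r_refl by (auto simp: C_def \<kappa>_def)
      with that have "L (indicator {i})" by (simp add: G_def)
      then show ?thesis using False by (simp add: b_def)
    qed
    have b0: "(\<Sum>i\<in>F. d i * b i e) = 0" for e
    proof -
      have "(\<Sum>i\<in>F. d i * b i e) = (\<Sum>i\<in>\<Union>C. d i * b i e)"
        using assms(1) \<open>\<Union>C \<subseteq> F\<close> by (intro sum.mono_neutral_right) (auto simp: b_def)
      also have "\<dots> = (\<Sum>k\<in>C. \<Sum>i\<in>k. d i * b i e)"
        using finC disj[unfolded pairwise_def disjnt_def]
        by (intro sum.Union_disjoint[unfolded comp_def]) blast+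
      also have "\<dots> = (\<Sum>k\<in>C. sum d k * indicator {\<sigma> k} e)"
      proof (intro sum.cong refl)
        fix k assume k: "k \<in> C"
        have "b i e = indicator {\<sigma> k} e" if "i \<in> k" for i
        proof -
          obtain i' where "k = \<kappa> i'" using k by (auto simp: C_def)
          moreover from this have "r i' i" using that by (simp add: \<kappa>_def)
          ultimately have "k = \<kappa> i" using \<kappa>_eq by simp
          moreover have "i \<in> \<Union>C" using that k by blast
          ultimately show ?thesis by (simp add: b_def)
        qed
        then show "(\<Sum>i\<in>k. d i * b i e) = sum d k * indicator {\<sigma> k} e"
          by (simp add: sum_distrib_right)
      qed
      also have "\<dots> = 0" using d(2) by simp
      finally show ?thesis .
    qed
    have "(\<Sum>i\<in>F. d i * indicator {i} e) = d e" for e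
    proof -
      have "(\<Sum>i\<in>F. d i * indicator {i} e) = (\<Sum>i\<in>F. if e = i then d i else 0)"
        by (intro sum.cong) auto
      also have "\<dots> = d e" using d(1) assms(1) by simp
      finally show ?thesis .
    qed
    with b0 have "(\<Sum>i\<in>F. d i * (indicator {i} e - b i e)) = d e" for e
      by (simp only: right_diff_distrib sum_subtractf diff_zero)
    moreover have "L (\<lambda>e. \<Sum>i\<in>F. d i * (indicator {i} e - b i e))"
      using L by (rule sum)
    ultimately show ?thesis by (simp only:)
  qed
  ultimately show ?thesis
    using \<open>finite C\<close> \<open>\<Union>C \<subseteq> F\<close> disj
    by (intro that[of C]) (assumption | linarith | blast)+
qed

end

text \<open>A dimension count: each structure costs at most half of \<open>card F\<close> equations.
  If the total is smaller than \<open>card F\<close>, a nonzero solution exists at once.\<close>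

lemma common_direction:
  assumes "function_subspace L" "function_subspace M" "finite F" "F \<noteq> {}"
    and "\<And>i. i \<in> F \<Longrightarrow> \<exists>S j. S \<subseteq> {j} \<and> S \<subseteq> F - {i} \<and> L (\<lambda>e. indicator S e - indicator {i} e)"
    and "\<And>i. i \<in> F \<Longrightarrow> \<exists>S j. S \<subseteq> {j} \<and> S \<subseteq> F - {i} \<and> M (\<lambda>e. indicator S e - indicator {i} e)"
  shows "\<exists>d. (\<forall>e. e \<notin> F \<longrightarrow> d e = 0) \<and> (\<exists>e. d e \<noteq> 0) \<and> L d \<and> M d"
proof -
  obtain C where C: "finite C" "\<Union>C \<subseteq> F" "pairwise disjnt C" "2 * card C \<le> card F"
    "2 * card C = card F \<Longrightarrow> \<Union>C = F"
    "\<And>d. (\<forall>e. e \<notin> F \<longrightarrow> d e = 0) \<Longrightarrow> (\<forall>k\<in>C. sum d k = 0) \<Longrightarrow> L d"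
    by (rule function_subspace.constraint_classes[OF assms(1,3) assms(5)]) (assumption, rule that)
  obtain C' where C': "finite C'" "\<Union>C' \<subseteq> F" "pairwise disjnt C'" "2 * card C' \<le> card F"
    "2 * card C' = card F \<Longrightarrow> \<Union>C' = F"
    "\<And>d. (\<forall>e. e \<notin> F \<longrightarrow> d e = 0) \<Longrightarrow> (\<forall>k\<in>C'. sum d k = 0) \<Longrightarrow> M d"
    by (rule function_subspace.constraint_classes[OF assms(2,3) assms(6)]) (assumption, rule that)
  have sum_indicator: "(\<Sum>e\<in>F. indicator k e * d e) = sum d k" if "k \<subseteq> F" for k and d :: "'a \<Rightarrow> real"
    using that assms(3) by (simp add: indicator_def if_distrib sum.If_cases Int_absorb1 cong: if_cong)
  have solve: "\<exists>d :: 'a \<Rightarrow> real. (\<forall>e. e \<notin> F \<longrightarrow> d e = 0) \<and> (\<exists>e. d e \<noteq> 0) \<and> (\<forall>k\<in>K. sum d k = 0)"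
    if K: "finite K" "card K < card F" "\<Union>K \<subseteq> F" for K :: "'a set set"
  proof -
    obtain d :: "'a \<Rightarrow> real" where d: "\<forall>e. e \<notin> F \<longrightarrow> d e = 0" "\<exists>e. d e \<noteq> 0"
      "\<forall>k\<in>K. (\<Sum>e\<in>F. indicator k e * d e) = 0"
      using underdetermined_system[OF K(1) assms(3) K(2), of "indicator"] by blast
    moreover have "sum d k = 0" if "k \<in> K" for k
      using d(3) that sum_indicator[of k d] K(3) by auto
    ultimately show ?thesis by blast
  qed
  have sum_union: "sum d (\<Union>K) = (\<Sum>k\<in>K. sum d k)" if "\<Union>K \<subseteq> F" "pairwise disjnt K"
    for K :: "'a set set" and d :: "'a \<Rightarrow> real"
  proof -
    have "\<forall>k\<in>K. finite k" using that(1) assms(3) by (meson Sup_le_iff finite_subset)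
    with that(2)[unfolded pairwise_def disjnt_def] show ?thesis
      by (intro sum.Union_disjoint[unfolded comp_def]) blast+
  qed
  show ?thesis
  proof (cases "card C + card C' < card F")
    case True
    then have "card (C \<union> C') < card F" using card_Un_le[of C C'] by linarith
    moreover have "finite (C \<union> C')" "\<Union>(C \<union> C') \<subseteq> F" using C(1,2) C'(1,2) by simp_all
    ultimately obtain d :: "'a \<Rightarrow> real" where d: "\<forall>e. e \<notin> F \<longrightarrow> d e = 0" "\<exists>e. d e \<noteq> 0"
      "\<forall>k\<in>C \<union> C'. sum d k = 0"
      using solve[of "C \<union> C'"] by blast
    then have "L d" "M d" using C(6)[of d] C'(6)[of d] by simp_all
    with d(1,2) show ?thesis by blast
  next
    case False
    \<comment> \<open>Now \<open>C\<close> and \<open>C'\<close> both partition \<open>F\<close>, so one of the constraints is redundant.\<close>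
    then have eq: "\<Union>C = F" "\<Union>C' = F" using C(4,5) C'(4,5) by linarith+
    then obtain k\<^sub>0 where k0: "k\<^sub>0 \<in> C'" using assms(4) by auto
    have "card (C \<union> (C' - {k\<^sub>0})) \<le> card C + card (C' - {k\<^sub>0})" by (rule card_Un_le)
    also have "\<dots> < card C + card C'" using k0 C'(1) by (meson add_less_cancel_left card_Diff1_less)
    also have "\<dots> \<le> card F" using C(4) C'(4) by linarith
    finally have "card (C \<union> (C' - {k\<^sub>0})) < card F" .
    moreover have "finite (C \<union> (C' - {k\<^sub>0}))" using C(1) C'(1) by simp
    moreover have "\<Union>(C \<union> (C' - {k\<^sub>0})) \<subseteq> F" using C(2) C'(2) by blast
    ultimately obtain d :: "'a \<Rightarrow> real" where d: "\<forall>e. e \<notin> F \<longrightarrow> d e = 0" "\<exists>e. d e \<noteq> 0"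
      "\<forall>k\<in>C \<union> (C' - {k\<^sub>0}). sum d k = 0"
      using solve[of "C \<union> (C' - {k\<^sub>0})"] by blast
    \<comment> \<open>Both families add up to the sum of \<open>d\<close> over \<open>F\<close>,
      which recovers the omitted equation at \<open>k\<^sub>0\<close>.\<close>
    have "(\<Sum>k\<in>C'. sum d k) = (\<Sum>k\<in>C. sum d k)"
      using sum_union[OF C(2,3)] sum_union[OF C'(2,3)] eq by metis
    also have "\<dots> = 0" using d(3) by simp
    also have "(\<Sum>k\<in>C'. sum d k) = sum d k\<^sub>0"
      using sum.remove[OF C'(1) k0, of "sum d"] d(3) by simp
    finally have "\<forall>k\<in>C'. sum d k = 0" using d(3) by auto
    then have "L d" "M d" using C(6)[of d] C'(6)[of d] d by simp_all
    with d(1,2) show ?thesis by blast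
  qed
qed

section \<open>Integrality of valuated intersection\<close>

text \<open>If \<open>l\<close> is optimal for its marginals, this says that the concave closure of
  \<open>g\<close> stays above a linear function of slope \<open>s\<close> along both
  \<open>d\<close> and \<open>- d\<close>; concavity then makes it linear near that point.\<close>

definition linear_direction :: "'a set set \<Rightarrow> ('a set \<Rightarrow> real) \<Rightarrow> ('a set \<Rightarrow> real) \<Rightarrow>
    ('a \<Rightarrow> real) \<Rightarrow> real \<Rightarrow> bool" where
  "linear_direction D g l d s \<longleftrightarrow> (\<exists>\<epsilon>>0. \<forall>t. \<bar>t\<bar> \<le> \<epsilon> \<longrightarrow> (\<exists>m\<in>prob_weights D.
     (\<forall>e. mean D m (\<lambda>Z. indicator Z e) = mean D l (\<lambda>Z. indicator Z e) + t * d e) \<and>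
     mean D l g + t * s \<le> mean D m g))"

text \<open>A sum of directions is realised by going twice as far along each and mixing the results
  in equal parts, which halves the radius. For multiples, the radius is divided by
  \<open>\<bar>c\<bar> + 1\<close>, which is safe for \<open>c = 0\<close>.\<close>

lemma function_subspace_linear_direction:
  assumes "l \<in> prob_weights D"
  shows "function_subspace (\<lambda>d. \<exists>s. linear_direction D g l d s)"
proof
  show "\<exists>s. linear_direction D g l (\<lambda>_. 0) s"
    unfolding linear_direction_def using assms by (intro exI[of _ 0] exI[of _ 1]) auto
next
  fix d d' assume "\<exists>s. linear_direction D g l d s" "\<exists>s. linear_direction D g l d' s"
  then obtain s s' \<epsilon> \<epsilon>' where pos: "0 < \<epsilon>" "0 < \<epsilon>'"
    and m: "\<And>t. \<bar>t\<bar> \<le> \<epsilon> \<Longrightarrow> \<exists>m\<in>prob_weights D.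
     (\<forall>e. mean D m (\<lambda>Z. indicator Z e) = mean D l (\<lambda>Z. indicator Z e) + t * d e) \<and>
     mean D l g + t * s \<le> mean D m g"
    and m': "\<And>t. \<bar>t\<bar> \<le> \<epsilon>' \<Longrightarrow> \<exists>m\<in>prob_weights D.
     (\<forall>e. mean D m (\<lambda>Z. indicator Z e) = mean D l (\<lambda>Z. indicator Z e) + t * d' e) \<and>
     mean D l g + t * s' \<le> mean D m g"
    unfolding linear_direction_def by blast
  have "\<exists>m\<in>prob_weights D.
     (\<forall>e. mean D m (\<lambda>Z. indicator Z e) = mean D l (\<lambda>Z. indicator Z e) + t * (d e + d' e)) \<and>
     mean D l g + t * (s + s') \<le> mean D m g" if t: "\<bar>t\<bar> \<le> min \<epsilon> \<epsilon>' / 2" for t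
  proof -
    have "\<bar>2 * t\<bar> \<le> \<epsilon>" "\<bar>2 * t\<bar> \<le> \<epsilon>'" using t by auto
    then obtain p q where p: "p \<in> prob_weights D" "mean D l g + 2 * t * s \<le> mean D p g"
      "\<And>e. mean D p (\<lambda>Z. indicator Z e) = mean D l (\<lambda>Z. indicator Z e) + 2 * t * d e"
      and q: "q \<in> prob_weights D" "mean D l g + 2 * t * s' \<le> mean D q g"
      "\<And>e. mean D q (\<lambda>Z. indicator Z e) = mean D l (\<lambda>Z. indicator Z e) + 2 * t * d' e"
      using m[of "2 * t"] m'[of "2 * t"] by blast
    let ?m = "\<lambda>Z. (1 - 1 / 2) * p Z + 1 / 2 * q Z"
    have "?m \<in> prob_weights D" using p(1) q(1) by (rule prob_weights_mix) auto
    moreover have "mean D l g + t * (s + s') \<le> mean D ?m g"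
      unfolding mean_mix using p(2) q(2) by (simp add: field_simps)
    moreover have "\<forall>e. mean D ?m (\<lambda>Z. indicator Z e) = mean D l (\<lambda>Z. indicator Z e) + t * (d e + d' e)"
      unfolding mean_mix p(3) q(3) by (simp add: field_simps)
    ultimately show ?thesis by blast
  qed
  then show "\<exists>s. linear_direction D g l (\<lambda>e. d e + d' e) s"
    unfolding linear_direction_def using pos
    by (intro exI[of _ "s + s'"] exI[of _ "min \<epsilon> \<epsilon>' / 2"]) auto
next
  fix d c assume "\<exists>s. linear_direction D g l d s"
  then obtain s \<epsilon> where pos: "0 < \<epsilon>"
    and m: "\<And>t. \<bar>t\<bar> \<le> \<epsilon> \<Longrightarrow> \<exists>m\<in>prob_weights D.
     (\<forall>e. mean D m (\<lambda>Z. indicator Z e) = mean D l (\<lambda>Z. indicator Z e) + t * d e) \<and>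
     mean D l g + t * s \<le> mean D m g"
    unfolding linear_direction_def by blast
  have "\<exists>m\<in>prob_weights D.
     (\<forall>e. mean D m (\<lambda>Z. indicator Z e) = mean D l (\<lambda>Z. indicator Z e) + t * (c * d e)) \<and>
     mean D l g + t * (c * s) \<le> mean D m g" if t: "\<bar>t\<bar> \<le> \<epsilon> / (\<bar>c\<bar> + 1)" for t
  proof -
    have "\<bar>t * c\<bar> \<le> \<bar>t\<bar> * (\<bar>c\<bar> + 1)" unfolding abs_mult by (intro mult_left_mono) auto
    also have "\<dots> \<le> \<epsilon>" using t by (subst (asm) pos_le_divide_eq) auto
    finally show ?thesis using m[of "t * c"] by (simp add: mult.assoc)
  qed
  then show "\<exists>s. linear_direction D g l (\<lambda>e. c * d e) s"
    unfolding linear_direction_def using pos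
    by (intro exI[of _ "c * s"] exI[of _ "\<epsilon> / (\<bar>c\<bar> + 1)"]) auto
qed

section \<open>Moving weight between sets of the support\<close>

definition shift_mass :: "'b \<Rightarrow> 'b \<Rightarrow> real \<Rightarrow> ('b \<Rightarrow> real) \<Rightarrow> 'b \<Rightarrow> real" where
  "shift_mass x y t l z = l z + t * (of_bool (z = y) - of_bool (z = x))"

lemma mean_shift_mass:
  assumes "finite D" "x \<in> D" "y \<in> D"
  shows "mean D (shift_mass x y t l) h = mean D l h + t * (h y - h x)"
proof -
  have "mean D (shift_mass x y t l) h = mean D l h +
      t * (mean D (\<lambda>z. of_bool (z = y)) h - mean D (\<lambda>z. of_bool (z = x)) h)"
    unfolding mean_def shift_mass_def
    by (simp only: distrib_right left_diff_distrib sum.distrib sum_subtractf mult.assoc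
        right_diff_distrib sum_distrib_left)
  then show ?thesis using assms by (simp add: mean_point)
qed

lemma prob_weights_shift_mass:
  assumes "finite D" "x \<in> D" "y \<in> D" "l \<in> prob_weights D" "0 \<le> t" "t \<le> l x"
  shows "shift_mass x y t l \<in> prob_weights D"
proof -
  have "sum (shift_mass x y t l) D = sum l D"
    using mean_shift_mass[OF assms(1-3), of t l "\<lambda>_. 1"] by (simp add: mean_def)
  moreover have "0 \<le> shift_mass x y t l z" for z
    using assms(4-6) by (auto simp: shift_mass_def prob_weights_def)
  ultimately show ?thesis
    using assms by (auto simp: prob_weights_def) (auto simp: shift_mass_def)
qed

text \<open>Optimality turns the exchange inequality into an equality, so the forward and the backward move
have opposite slopes.\<close>
lemma exchange_direction:
  assumes "exch D g" "finite D" "l \<in> prob_weights D"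
    and opt: "\<And>m. m \<in> prob_weights D \<Longrightarrow>
      (\<forall>e. mean D m (\<lambda>Z. indicator Z e) = mean D l (\<lambda>Z. indicator Z e)) \<Longrightarrow> mean D m g \<le> mean D l g"
    and "X \<in> D" "Y \<in> D" "0 < l X" "0 < l Y" "i \<in> X" "i \<notin> Y"
  shows "\<exists>S j s. S \<subseteq> {j} \<and> S \<subseteq> Y - X \<and> linear_direction D g l (\<lambda>e. indicator S e - indicator {i} e) s"
proof -
  obtain S j where S: "S \<subseteq> Y - X" "S \<subseteq> {j}"
    and A: "(X - {i}) \<union> S \<in> D" (is "?A \<in> D") and B: "insert i Y - S \<in> D" (is "?B \<in> D")
    and le: "g X + g Y \<le> g ((X - {i}) \<union> S) + g (insert i Y - S)"
    by (rule exchE[OF assms(1) \<open>X \<in> D\<close> \<open>Y \<in> D\<close> \<open>i \<in> X\<close> \<open>i \<notin> Y\<close>]) (rule that)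
  \<comment> \<open>Replacing \<open>X\<close> by \<open>?A\<close> and replacing \<open>Y\<close>
    by \<open>?B\<close> change the marginals in opposite ways, so doing both at once leaves them
    fixed.\<close>
  have ind: "indicator ?A e - indicator X e = indicator S e - (indicator {i} e :: real)"
    "indicator ?B e - indicator Y e = - (indicator S e - (indicator {i} e :: real))" for e
    using S \<open>i \<in> X\<close> \<open>i \<notin> Y\<close> by (auto simp: indicator_def)
  define \<epsilon> where "\<epsilon> = min (l X) (l Y)"
  have \<epsilon>: "0 < \<epsilon>" "\<epsilon> \<le> l X" "\<epsilon> \<le> l Y" using assms by (auto simp: \<epsilon>_def)
  let ?l = "shift_mass X ?A \<epsilon> l" and ?m = "shift_mass Y ?B \<epsilon> (shift_mass X ?A \<epsilon> l)"
  have "?l \<in> prob_weights D"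
    using \<epsilon> by (intro prob_weights_shift_mass[OF assms(2) \<open>X \<in> D\<close> A assms(3)]) simp_all
  \<comment> \<open>\<open>X\<close> and \<open>Y\<close> differ at \<open>i\<close>, so the first
    move takes nothing from \<open>Y\<close>.\<close>
  moreover have "\<epsilon> \<le> ?l Y"
    using \<epsilon> \<open>i \<in> X\<close> \<open>i \<notin> Y\<close> by (auto simp: shift_mass_def)
  ultimately have "?m \<in> prob_weights D"
    using \<epsilon> by (intro prob_weights_shift_mass[OF assms(2) \<open>Y \<in> D\<close> B]) simp_all
  moreover have "mean D ?m h = mean D l h + \<epsilon> * (h ?A - h X) + \<epsilon> * (h ?B - h Y)" for h
    using assms A B by (simp add: mean_shift_mass)
  ultimately have "\<epsilon> * (g ?A - g X) + \<epsilon> * (g ?B - g Y) \<le> 0"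
    using opt[of ?m] by (simp add: ind flip: distrib_left)
  then have "\<epsilon> * (g ?A - g X + (g ?B - g Y)) \<le> 0" by (simp add: distrib_left)
  then have "g ?A - g X + (g ?B - g Y) \<le> 0" using \<epsilon>(1) by (simp add: mult_le_0_iff)
  with le have eq: "g ?B - g Y = - (g ?A - g X)" by linarith
  have "\<exists>m\<in>prob_weights D.
     (\<forall>e. mean D m (\<lambda>Z. indicator Z e) = mean D l (\<lambda>Z. indicator Z e) +
        t * (indicator S e - indicator {i} e)) \<and>
     mean D l g + t * (g ?A - g X) \<le> mean D m g" if t: "\<bar>t\<bar> \<le> \<epsilon>" for t
  \<comment> \<open>Positive \<open>t\<close> moves weight from \<open>X\<close> to
    \<open>?A\<close>, negative \<open>t\<close> moves it from \<open>Y\<close> to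
    \<open>?B\<close>.\<close>
  proof (cases "0 \<le> t")
    case True
    have "shift_mass X ?A t l \<in> prob_weights D"
      using t True \<epsilon> by (intro prob_weights_shift_mass[OF assms(2) \<open>X \<in> D\<close> A assms(3)]) simp_all
    then show ?thesis
      by (rule bexI[rotated]) (simp add: mean_shift_mass[OF assms(2) \<open>X \<in> D\<close> A] ind)
  next
    case False
    have "shift_mass Y ?B (- t) l \<in> prob_weights D"
      using t False \<epsilon> by (intro prob_weights_shift_mass[OF assms(2) \<open>Y \<in> D\<close> B assms(3)]) simp_all
    then show ?thesis
      by (rule bexI[rotated]) (simp add: mean_shift_mass[OF assms(2) \<open>Y \<in> D\<close> B] ind eq right_diff_distrib)
  qed
  with \<epsilon>(1) have "linear_direction D g l (\<lambda>e. indicator S e - indicator {i} e) (g ?A - g X)"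
    unfolding linear_direction_def by blast
  with S show ?thesis by blast
qed

section \<open>Fractional marginals and the sets of the support\<close>

lemma mean_pos_imp:
  assumes "l \<in> prob_weights D" "0 < mean D l (\<lambda>Z. indicator Z e)"
  obtains Z where "Z \<in> D" "0 < l Z" "e \<in> Z"
proof -
  have "\<exists>Z\<in>D. l Z * indicator Z e \<noteq> 0"
    using assms(2) unfolding mean_def by (metis (mono_tags, lifting) less_irrefl sum.neutral)
  then obtain Z where Z: "Z \<in> D" "l Z * indicator Z e \<noteq> 0" by blast
  moreover have "0 \<le> l Z" using assms(1) by (simp add: prob_weights_def)
  ultimately show ?thesis using that[of Z] by (auto simp: indicator_def split: if_splits)
qed

lemma mean_indicator_ge:
  assumes "finite D" "l \<in> prob_weights D" "Z \<in> D" "e \<in> Z"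
  shows "l Z \<le> mean D l (\<lambda>Z. indicator Z e)"
proof -
  have "l Z * indicator Z e \<le> mean D l (\<lambda>Z. indicator Z e)"
    unfolding mean_def using assms by (intro member_le_sum) (auto simp: prob_weights_def)
  then show ?thesis using assms by simp
qed

lemma mean_indicator_complement:
  assumes "l \<in> prob_weights D"
  shows "mean D l (\<lambda>Z. indicator (- Z) e) = 1 - mean D l (\<lambda>Z. indicator Z e)"
  using assms unfolding mean_def prob_weights_def
  by (simp add: indicator_compl right_diff_distrib sum_subtractf)

lemma mean_less_one_imp:
  assumes "l \<in> prob_weights D" "mean D l (\<lambda>Z. indicator Z e) < 1"
  obtains Z where "Z \<in> D" "0 < l Z" "e \<notin> Z"
proof -
  have "0 < mean D l (\<lambda>Z. indicator (- Z) e)"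
    using assms by (simp add: mean_indicator_complement)
  then have "\<exists>Z\<in>D. l Z * indicator (- Z) e \<noteq> (0 :: real)"
    unfolding mean_def by (metis (mono_tags, lifting) less_irrefl sum.neutral)
  then obtain Z where Z: "Z \<in> D" "l Z * indicator (- Z) e \<noteq> (0 :: real)" by blast
  moreover have "0 \<le> l Z" using assms(1) by (simp add: prob_weights_def)
  ultimately show ?thesis using that[of Z] by (auto simp: indicator_def split: if_splits)
qed

lemma mean_indicator_le:
  assumes "finite D" "l \<in> prob_weights D" "Z \<in> D" "e \<notin> Z"
  shows "mean D l (\<lambda>Z. indicator Z e) \<le> 1 - l Z"
proof -
  have "l Z * indicator (- Z) e \<le> mean D l (\<lambda>Z. indicator (- Z) e)"
    unfolding mean_def using assms by (intro member_le_sum) (auto simp: prob_weights_def)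
  then show ?thesis using assms by (simp add: mean_indicator_complement)
qed

text \<open>A fractional \<open>i\<close> lies in some set \<open>X\<close> of the support and
  outside another set \<open>Y\<close>. A partner from \<open>Y - X\<close> is fractional as well,
  since \<open>Y\<close> contains it and \<open>X\<close> avoids it, both with positive
  weight.\<close>

lemma fractional_partner:
  assumes "exch D g" "finite D" "l \<in> prob_weights D"
    and opt: "\<And>m. m \<in> prob_weights D \<Longrightarrow>
      (\<forall>e. mean D m (\<lambda>Z. indicator Z e) = mean D l (\<lambda>Z. indicator Z e)) \<Longrightarrow> mean D m g \<le> mean D l g"
    and F: "F = {e. 0 < mean D l (\<lambda>Z. indicator Z e) \<and> mean D l (\<lambda>Z. indicator Z e) < 1}"
    and "i \<in> F"
  shows "\<exists>S j. S \<subseteq> {j} \<and> S \<subseteq> F - {i} \<and>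
    (\<exists>s. linear_direction D g l (\<lambda>e. indicator S e - indicator {i} e) s)"
proof -
  obtain X where X: "X \<in> D" "0 < l X" "i \<in> X"
    using mean_pos_imp[OF assms(3), of i] \<open>i \<in> F\<close> F by blast
  obtain Y where Y: "Y \<in> D" "0 < l Y" "i \<notin> Y"
    using mean_less_one_imp[OF assms(3), of i] \<open>i \<in> F\<close> F by blast
  obtain S j s where S: "S \<subseteq> {j}" "S \<subseteq> Y - X"
    "linear_direction D g l (\<lambda>e. indicator S e - indicator {i} e) s"
    using exchange_direction[OF assms(1-3) opt X(1) Y(1) X(2) Y(2) X(3) Y(3)] by blast
  have "e \<in> F" if "e \<in> S" for e
  proof -
    have "e \<in> Y" "e \<notin> X" using that S(2) by auto
    then show ?thesis
      using mean_indicator_ge[OF assms(2,3) Y(1), of e] mean_indicator_le[OF assms(2,3) X(1), of e] X(2) Y(2)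
      unfolding F by simp
  qed
  moreover have "i \<notin> S" using S(2) Y(3) by auto
  ultimately show ?thesis using S by (intro exI[of _ S] exI[of _ j]) blast
qed

section \<open>Optimal pairs of weights with common marginals\<close>

lemma compact_equal_marginals:
  assumes "finite D" "finite E"
  shows "compact {lm \<in> prob_weights D \<times> prob_weights E.
    \<forall>e. mean D (fst lm) (\<lambda>Z. indicator Z e) = mean E (snd lm) (\<lambda>Z. indicator Z e)}"
proof -
  have "closed {lm. mean D (fst lm) (\<lambda>Z. indicator Z e) = mean E (snd lm) (\<lambda>Z. indicator Z e)}" for e
    using assms by (intro closed_Collect_eq continuous_on_compose2[OF continuous_on_mean] continuous_intros) auto
  then have "closed {lm. \<forall>e. mean D (fst lm) (\<lambda>Z. indicator Z e) = mean E (snd lm) (\<lambda>Z. indicator Z e)}"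
    by (rule closed_Collect_all)
  then have "compact ((prob_weights D \<times> prob_weights E) \<inter>
      {lm. \<forall>e. mean D (fst lm) (\<lambda>Z. indicator Z e) = mean E (snd lm) (\<lambda>Z. indicator Z e)})"
    by (rule compact_Int_closed[OF compact_Times[OF assms[THEN compact_prob_weights]]])
  then show ?thesis by (simp only: Int_def mem_Collect_eq)
qed

text \<open>The integrality of weighted matroid intersection in valuated form. On the compact set of
  optimal pairs, a strictly convex function of the marginals has its maximum only where no two-sided
  motion of the marginals is possible.\<close>

lemma valuated_intersection_integral:
  assumes "finite N" "D \<subseteq> Pow N" "E \<subseteq> Pow N" "exch D g" "exch E h"
    and "l\<^sub>0 \<in> prob_weights D" "m\<^sub>0 \<in> prob_weights E"
    and "\<And>e. mean D l\<^sub>0 (\<lambda>Z. indicator Z e) = mean E m\<^sub>0 (\<lambda>Z. indicator Z e)"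
  shows "\<exists>J\<in>D \<inter> E. mean D l\<^sub>0 g + mean E m\<^sub>0 h \<le> g J + h J"
proof -
  have finD: "finite D" and finE: "finite E" using assms(1-3) by (auto intro: finite_subset)
  define P where "P = {lm \<in> prob_weights D \<times> prob_weights E.
    \<forall>e. mean D (fst lm) (\<lambda>Z. indicator Z e) = mean E (snd lm) (\<lambda>Z. indicator Z e)}"
  define V where "V lm = mean D (fst lm) g + mean E (snd lm) h" for lm
  define Q where "Q lm = (\<Sum>e\<in>N. (mean D (fst lm) (\<lambda>Z. indicator Z e))\<^sup>2)" for lm :: "('a set \<Rightarrow> real) \<times> ('a set \<Rightarrow> real)"
  have contV: "continuous_on UNIV V"
    unfolding V_def using finD finE
    by (intro continuous_intros continuous_on_compose2[OF continuous_on_mean]) auto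
  have contQ: "continuous_on UNIV Q"
    unfolding Q_def using finD
    by (intro continuous_intros continuous_on_compose2[OF continuous_on_mean]) auto
  have compP: "compact P" unfolding P_def using finD finE by (rule compact_equal_marginals)
  have inP: "(l\<^sub>0, m\<^sub>0) \<in> P" using assms(6-8) by (simp add: P_def)
  obtain w\<^sub>0 where w0: "w\<^sub>0 \<in> P" "\<And>w. w \<in> P \<Longrightarrow> V w \<le> V w\<^sub>0"
    using continuous_attains_sup[OF compP _ continuous_on_subset[OF contV subset_UNIV]] inP by blast
  \<comment> \<open>Second stage: among the pairs of maximal value, one with maximal
    \<open>Q\<close> is selected.\<close>
  have "compact (P \<inter> {w. V w\<^sub>0 \<le> V w})"
    by (intro compact_Int_closed compP closed_Collect_le continuous_on_const contV)
  moreover have "w\<^sub>0 \<in> P \<inter> {w. V w\<^sub>0 \<le> V w}" using w0 by simp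
  ultimately obtain w where w: "w \<in> P" "V w\<^sub>0 \<le> V w"
    and Qmax: "\<And>u. u \<in> P \<Longrightarrow> V w\<^sub>0 \<le> V u \<Longrightarrow> Q u \<le> Q w"
    using continuous_attains_sup[OF _ _ continuous_on_subset[OF contQ subset_UNIV], of "P \<inter> {w. V w\<^sub>0 \<le> V w}"]
    by blast
  obtain l m where lm: "w = (l, m)" by fastforce
  have l: "l \<in> prob_weights D" and m: "m \<in> prob_weights E"
    and eq: "mean E m (\<lambda>Z. indicator Z e) = mean D l (\<lambda>Z. indicator Z e)" for e
    using w(1) by (simp_all add: lm P_def)
  have Vmax: "mean D l' g + mean E m' h \<le> mean D l g + mean E m h"
    if "l' \<in> prob_weights D" "m' \<in> prob_weights E"
      "\<And>e. mean D l' (\<lambda>Z. indicator Z e) = mean E m' (\<lambda>Z. indicator Z e)" for l' m'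
    using w0(2)[of "(l', m')"] w(2) that by (simp add: P_def V_def lm)
  define x where "x e = mean D l (\<lambda>Z. indicator Z e)" for e
  define F where "F = {e. 0 < x e \<and> x e < 1}"
  have x_outside: "x e = 0" if "e \<notin> N" for e
    using that assms(2) unfolding x_def mean_def by (intro sum.neutral) (auto simp: indicator_def)
  have "F \<subseteq> N" using x_outside by (force simp: F_def)
  then have "finite F" using assms(1) by (rule finite_subset)
  have "F = {}"
  proof (rule ccontr)
    assume "F \<noteq> {}"
    \<comment> \<open>Joint optimality gives optimality of each component for its fixed marginals,
      by keeping the other component.\<close>
    have optD: "mean D l' g \<le> mean D l g" if "l' \<in> prob_weights D"
      "\<forall>e. mean D l' (\<lambda>Z. indicator Z e) = mean D l (\<lambda>Z. indicator Z e)" for l'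
      using Vmax[OF that(1) m] that(2) eq by simp
    have optE: "mean E m' h \<le> mean E m h" if "m' \<in> prob_weights E"
      "\<forall>e. mean E m' (\<lambda>Z. indicator Z e) = mean E m (\<lambda>Z. indicator Z e)" for m'
      using Vmax[OF l that(1)] that(2) eq by simp
    obtain d e\<^sub>0 s s' where d: "\<And>e. e \<notin> F \<Longrightarrow> d e = 0" "d e\<^sub>0 \<noteq> 0"
      "linear_direction D g l d s" "linear_direction E h m d s'"
      using common_direction[OF function_subspace_linear_direction[OF l]
          function_subspace_linear_direction[OF m] \<open>finite F\<close> \<open>F \<noteq> {}\<close>
          fractional_partner[OF assms(4) finD l optD F_def[unfolded x_def]]
          fractional_partner[OF assms(5) finE m optE F_def[unfolded x_def, folded eq]]]
      by blast
    obtain \<epsilon> where "0 < \<epsilon>" and \<epsilon>: "\<And>t. \<bar>t\<bar> \<le> \<epsilon> \<Longrightarrow> \<exists>l'\<in>prob_weights D.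
     (\<forall>e. mean D l' (\<lambda>Z. indicator Z e) = x e + t * d e) \<and> mean D l g + t * s \<le> mean D l' g"
      using d(3) unfolding linear_direction_def x_def by blast
    obtain \<epsilon>' where "0 < \<epsilon>'" and \<epsilon>': "\<And>t. \<bar>t\<bar> \<le> \<epsilon>' \<Longrightarrow> \<exists>m'\<in>prob_weights E.
     (\<forall>e. mean E m' (\<lambda>Z. indicator Z e) = x e + t * d e) \<and> mean E m h + t * s' \<le> mean E m' h"
      using d(4) unfolding linear_direction_def x_def eq by blast
    define \<delta> where "\<delta> = min \<epsilon> \<epsilon>'"
    have "0 < \<delta>" using \<open>0 < \<epsilon>\<close> \<open>0 < \<epsilon>'\<close> by (simp add: \<delta>_def)
    have move: "\<exists>u\<in>P. V w + t * (s + s') \<le> V u \<and> Q u = (\<Sum>e\<in>N. (x e + t * d e)\<^sup>2)" if t: "\<bar>t\<bar> \<le> \<delta>" for t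
    proof -
      obtain l' where l': "l' \<in> prob_weights D" "\<And>e. mean D l' (\<lambda>Z. indicator Z e) = x e + t * d e"
        "mean D l g + t * s \<le> mean D l' g" using \<epsilon>[of t] t by (auto simp: \<delta>_def)
      obtain m' where m': "m' \<in> prob_weights E" "\<And>e. mean E m' (\<lambda>Z. indicator Z e) = x e + t * d e"
        "mean E m h + t * s' \<le> mean E m' h" using \<epsilon>'[of t] t by (auto simp: \<delta>_def)
      show ?thesis
        using l' m' by (intro bexI[of _ "(l', m')"]) (auto simp: P_def V_def Q_def lm distrib_left)
    qed
    have V_eq: "V w = V w\<^sub>0" using w0(2)[OF w(1)] w(2) by simp
    obtain u where u: "u \<in> P" "V w + \<delta> * (s + s') \<le> V u" "Q u = (\<Sum>e\<in>N. (x e + \<delta> * d e)\<^sup>2)"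
      using move[of \<delta>] \<open>0 < \<delta>\<close> by auto
    obtain u' where u': "u' \<in> P" "V w + - \<delta> * (s + s') \<le> V u'" "Q u' = (\<Sum>e\<in>N. (x e + - \<delta> * d e)\<^sup>2)"
      using move[of "- \<delta>"] \<open>0 < \<delta>\<close> by auto
    \<comment> \<open>\<open>V\<close> can increase in neither direction, so the slopes cancel and
      both moved pairs remain optimal.\<close>
    have "\<delta> * (s + s') = 0" using u(2) u'(2) w0(2)[OF u(1)] w0(2)[OF u'(1)] V_eq by linarith
    then have "V w\<^sub>0 \<le> V u" "V w\<^sub>0 \<le> V u'" using u(2) u'(2) V_eq by linarith+
    then have "Q u \<le> Q w" "Q u' \<le> Q w" using u(1) u'(1) by (auto intro: Qmax)
    \<comment> \<open>The parallelogram identity: a symmetric move increases the average of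
      \<open>Q\<close>, against its maximality.\<close>
    moreover have "Q u + Q u' = 2 * Q w + 2 * \<delta>\<^sup>2 * (\<Sum>e\<in>N. (d e)\<^sup>2)"
      unfolding u(3) u'(3) by (simp add: Q_def lm x_def[symmetric] sum_distrib_left power2_eq_square
          algebra_simps flip: sum.distrib)
    moreover have "0 < (\<Sum>e\<in>N. (d e)\<^sup>2)"
      using assms(1) d(1,2) \<open>F \<subseteq> N\<close> by (intro sum_pos2[of N e\<^sub>0]) auto
    ultimately show False using \<open>0 < \<delta>\<close> by (smt (verit) mult_pos_pos zero_less_power)
  qed
  define J where "J = {e. 1 \<le> x e}"
  \<comment> \<open>A set of positive weight makes the marginal positive at its elements and less
    than 1 elsewhere. Without fractional entries this determines the set.\<close>
  have concentrated: "Z = J" if "Z \<in> C" "0 < k Z" "finite C" "k \<in> prob_weights C"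
      "\<And>e. mean C k (\<lambda>Z. indicator Z e) = x e" for Z C k
  proof (rule set_eqI)
    fix e
    have "e \<notin> F" using \<open>F = {}\<close> by simp
    then have "x e \<le> 0 \<or> 1 \<le> x e" by (auto simp: F_def)
    then show "e \<in> Z \<longleftrightarrow> e \<in> J"
      using mean_indicator_ge[OF that(3,4,1), of e] mean_indicator_le[OF that(3,4,1), of e] that(2)
      by (cases "e \<in> Z") (auto simp: J_def that(5))
  qed
  have point: "J \<in> C \<and> mean C k f = f J" if C: "finite C" "k \<in> prob_weights C"
      "\<And>e. mean C k (\<lambda>Z. indicator Z e) = x e" for C k and f :: "'a set \<Rightarrow> real"
  proof -
    have zero: "k Z = 0" if Z: "Z \<in> C" "Z \<noteq> J" for Z
    proof (rule ccontr)
      assume "k Z \<noteq> 0"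
      moreover have "0 \<le> k Z" using C(2) by (simp add: prob_weights_def)
      ultimately have "0 < k Z" by simp
      from concentrated[OF Z(1) this C] Z(2) show False by simp
    qed
    have one: "sum k C = 1" using C(2) by (simp add: prob_weights_def)
    have "J \<in> C"
    proof (rule ccontr)
      assume "J \<notin> C"
      then have "sum k C = 0" using zero by (intro sum.neutral) blast
      with one show False by simp
    qed
    moreover have "sum k C = k J"
      using sum.remove[OF C(1) \<open>J \<in> C\<close>, of k] zero by simp
    moreover have "mean C k f = k J * f J"
      unfolding mean_def using sum.remove[OF C(1) \<open>J \<in> C\<close>, of "\<lambda>Z. k Z * f Z"] zero by simp
    ultimately show ?thesis using one by simp
  qed
  have "J \<in> D" "mean D l g = g J" using point[OF finD l] by (simp_all add: x_def)
  moreover have "J \<in> E" "mean E m h = h J" using point[OF finE m] by (simp_all add: x_def eq)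
  moreover have "mean D l\<^sub>0 g + mean E m\<^sub>0 h \<le> mean D l g + mean E m h" by (rule Vmax) fact+
  ultimately show ?thesis by auto
qed

section \<open>The multiple exchange property\<close>

lemma exch_restrict:
  assumes "exch D g"
  shows "exch {Z \<in> D. Z \<subseteq> U} g"
  unfolding exch_def
proof (intro ballI, goal_cases)
  case (1 X Y i)
  then have "X \<in> D" "Y \<in> D" "i \<in> X" "i \<notin> Y" by auto
  then obtain S j where S: "S \<subseteq> Y - X" "S \<subseteq> {j}" "(X - {i}) \<union> S \<in> D" "insert i Y - S \<in> D"
    "g X + g Y \<le> g ((X - {i}) \<union> S) + g (insert i Y - S)"
    by (rule exchE[OF assms]) (rule that)
  moreover have "(X - {i}) \<union> S \<subseteq> U" "insert i Y - S \<subseteq> U" using S(1) 1 by auto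
  ultimately show ?case by (intro exI[of _ S] exI[of _ j]) simp
qed

lemma exch_contract:
  assumes "exch D g" "A \<inter> W = {}"
  shows "exch {J. J \<subseteq> W \<and> A \<union> J \<in> D} (\<lambda>J. g (A \<union> J))"
  unfolding exch_def
proof (intro ballI, goal_cases)
  case (1 J K i)
  then have i: "A \<union> J \<in> D" "A \<union> K \<in> D" "i \<in> A \<union> J" "i \<notin> A \<union> K" using assms(2) by auto
  obtain S j where S: "S \<subseteq> (A \<union> K) - (A \<union> J)" "S \<subseteq> {j}" "(A \<union> J - {i}) \<union> S \<in> D" "insert i (A \<union> K) - S \<in> D"
    "g (A \<union> J) + g (A \<union> K) \<le> g ((A \<union> J - {i}) \<union> S) + g (insert i (A \<union> K) - S)"
    by (rule exchE[OF assms(1) i]) (rule that)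
  have eq: "(A \<union> J - {i}) \<union> S = A \<union> ((J - {i}) \<union> S)" "insert i (A \<union> K) - S = A \<union> (insert i K - S)"
    using S(1) i(4) by auto
  have "S \<subseteq> K - J" "(J - {i}) \<union> S \<subseteq> W" "insert i K - S \<subseteq> W" using S(1) 1 by auto
  with S show ?case unfolding eq by (intro exI[of _ S] exI[of _ j]) simp
qed

text \<open>Complementation reverses the transfer of \<open>i\<close>, so the exchange in
  \<open>D\<close> is applied with the roles of \<open>J\<close> and \<open>K\<close>
  swapped.\<close>

lemma exch_reflect:
  assumes "exch D g" "I \<inter> Y = {}" "W \<subseteq> Y"
  shows "exch {J. J \<subseteq> W \<and> (Y - J) \<union> I \<in> D} (\<lambda>J. g ((Y - J) \<union> I))"
  unfolding exch_def
proof (intro ballI, goal_cases)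
  case (1 J K i)
  let ?P = "(Y - K) \<union> I" and ?Q = "(Y - J) \<union> I"
  have i: "?P \<in> D" "?Q \<in> D" "i \<in> ?P" "i \<notin> ?Q" using 1 assms(2,3) by auto
  obtain S j where S: "S \<subseteq> ?Q - ?P" "S \<subseteq> {j}" "(?P - {i}) \<union> S \<in> D" "insert i ?Q - S \<in> D"
    "g ?P + g ?Q \<le> g ((?P - {i}) \<union> S) + g (insert i ?Q - S)"
    by (rule exchE[OF assms(1) i]) (rule that)
  have S': "S \<subseteq> K - J" using S(1) by auto
  have "i \<in> Y" "i \<notin> I" using i assms(2) by auto
  then have eq: "(?P - {i}) \<union> S = (Y - (insert i K - S)) \<union> I"
    "insert i ?Q - S = (Y - ((J - {i}) \<union> S)) \<union> I"
    using S(1) by blast+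
  have "(J - {i}) \<union> S \<subseteq> W" "insert i K - S \<subseteq> W" using S' 1 by auto
  with S S' show ?case unfolding eq by (intro exI[of _ S] exI[of _ j]) (simp add: add.commute)
qed

text \<open>Duality produces weights on pairs; summing out one component gives the separate weights
  that the intersection argument needs.\<close>

lemma marginal_fst:
  assumes "l \<in> prob_weights (D \<times> E)" "finite D" "finite E"
  obtains m where "m \<in> prob_weights D" "\<And>f. mean D m f = mean (D \<times> E) l (\<lambda>z. f (fst z))"
proof
  let ?m = "\<lambda>x. \<Sum>y\<in>E. l (x, y)"
  show mean: "mean D ?m f = mean (D \<times> E) l (\<lambda>z. f (fst z))" for f
    unfolding mean_def by (simp add: sum_distrib_right sum.cartesian_product case_prod_beta)
  have "sum ?m D = 1"
    using mean[of "\<lambda>_. 1"] assms(1) by (simp add: mean_def prob_weights_def)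
  then show "?m \<in> prob_weights D"
    using assms(1) unfolding prob_weights_def by (auto intro!: sum_nonneg sum.neutral)
qed

lemma marginal_snd:
  assumes "l \<in> prob_weights (D \<times> E)" "finite D" "finite E"
  obtains m where "m \<in> prob_weights E" "\<And>f. mean E m f = mean (D \<times> E) l (\<lambda>z. f (snd z))"
proof
  let ?m = "\<lambda>y. \<Sum>x\<in>D. l (x, y)"
  show mean: "mean E ?m f = mean (D \<times> E) l (\<lambda>z. f (snd z))" for f
    unfolding mean_def
    by (simp add: sum_distrib_right, subst sum.swap) (simp add: sum.cartesian_product case_prod_beta)
  have "sum ?m E = 1"
    using mean[of "\<lambda>_. 1"] assms(1) by (simp add: mean_def prob_weights_def)
  then show "?m \<in> prob_weights E"
    using assms(1) unfolding prob_weights_def by (auto intro!: sum_nonneg sum.neutral)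
qed

text \<open>The real-valued core. Exchange with two sets \<open>J\<close> and \<open>K\<close>,
  under every price vector, is the dual bound; duality yields weights on pairs with equal marginals,
  and integrality merges \<open>J\<close> and \<open>K\<close> into one set.\<close>

lemma exch_multiple_exchange:
  assumes "exch D g" "finite N" "D \<subseteq> Pow N" "X \<in> D" "Y \<in> D" "I \<subseteq> X - Y"
  shows "\<exists>J. J \<subseteq> Y - X \<and> (X - I) \<union> J \<in> D \<and> (Y - J) \<union> I \<in> D \<and>
    g X + g Y \<le> g ((X - I) \<union> J) + g ((Y - J) \<union> I)"
proof -
  \<comment> \<open>Within \<open>X \<union> Y\<close>, whatever a set has outside \<open>X\<close>
    belongs to \<open>Y - X\<close>.\<close>
  define D' where "D' = {Z \<in> D. Z \<subseteq> X \<union> Y}"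
  have D': "exch D' g" "finite D'" "D' \<subseteq> Pow (X \<union> Y)" "X \<in> D'" "Y \<in> D'"
    using exch_restrict[OF assms(1)] finite_subset[OF assms(3)] assms(2,4,5) by (auto simp: D'_def)
  have XY: "finite X" "finite Y" "finite I" using assms by (auto intro: finite_subset)
  define W where "W = Y - X"
  have W: "finite W" "W \<subseteq> Y" "W \<inter> X = {}" using XY by (auto simp: W_def)
  define G where "G = {J. J \<subseteq> W \<and> (X - I) \<union> J \<in> D'}"
  define H where "H = {J. J \<subseteq> W \<and> (Y - J) \<union> I \<in> D'}"
  define g\<^sub>1 where "g\<^sub>1 J = g ((X - I) \<union> J)" for J
  define g\<^sub>2 where "g\<^sub>2 J = g ((Y - J) \<union> I)" for J
  have G: "exch G g\<^sub>1" "G \<subseteq> Pow W" "finite G"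
    using exch_contract[OF D'(1), of "X - I" W] W by (auto simp: G_def g\<^sub>1_def[abs_def])
  have H: "exch H g\<^sub>2" "H \<subseteq> Pow W" "finite H"
    using exch_reflect[OF D'(1), of I Y W] W assms(6) by (auto simp: H_def g\<^sub>2_def[abs_def])
  have dual: "\<exists>z\<in>G \<times> H. g X + g Y \<le> g\<^sub>1 (fst z) + g\<^sub>2 (snd z) +
      (\<Sum>e\<in>W. p e * (indicator (fst z) e - indicator (snd z) e))" for p
  proof -
    \<comment> \<open>The linear shift subtracts its prices, hence the sign here.\<close>
    let ?s = "\<lambda>Z. \<Sum>e\<in>W. - p e * indicator Z e"
    obtain J K where JK: "J \<subseteq> Y - X" "K \<subseteq> Y - X" "(X - I) \<union> J \<in> D'" "(Y - K) \<union> I \<in> D'"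
      and le: "(g X - ?s X) + (g Y - ?s Y) \<le> (g ((X - I) \<union> J) - ?s ((X - I) \<union> J)) + (g ((Y - K) \<union> I) - ?s ((Y - K) \<union> I))"
      using exch_partition_exchange[OF exch_linear_shift[OF D'(1), where W = W and p = "\<lambda>e. - p e"]
          D'(2-5) assms(6) \<open>finite I\<close>] by blast
    have "?s ((X - I) \<union> J) + ?s ((Y - K) \<union> I) - ?s X - ?s Y =
        (\<Sum>e\<in>W. - p e * (indicator ((X - I) \<union> J) e + indicator ((Y - K) \<union> I) e - indicator X e - indicator Y e))"
      by (simp only: right_diff_distrib distrib_left sum.distrib sum_subtractf)
    \<comment> \<open>On \<open>W\<close> the four indicators are those of \<open>J\<close>, of the
      complement of \<open>K\<close>, 0 for \<open>X\<close> and 1 for \<open>Y\<close>.\<close>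
    also have "\<dots> = (\<Sum>e\<in>W. - p e * (indicator J e - indicator K e))"
      using JK(1,2) assms(6) by (intro sum.cong) (auto simp: W_def indicator_def)
    also have "\<dots> = - (\<Sum>e\<in>W. p e * (indicator J e - indicator K e))"
      by (simp add: sum_negf)
    finally have "g X + g Y \<le> g\<^sub>1 J + g\<^sub>2 K + (\<Sum>e\<in>W. p e * (indicator J e - indicator K e))"
      using le unfolding g\<^sub>1_def g\<^sub>2_def by linarith
    moreover have "(J, K) \<in> G \<times> H" using JK by (simp add: G_def H_def W_def)
    ultimately show ?thesis by force
  qed
  have "G \<times> H \<noteq> {}" using dual[of "\<lambda>_. 0"] by auto
  then obtain q where q: "q \<in> prob_weights (G \<times> H)"
    "\<And>e. e \<in> W \<Longrightarrow> mean (G \<times> H) q (\<lambda>z. indicator (fst z) e - indicator (snd z) e) = 0"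
    "g X + g Y \<le> mean (G \<times> H) q (\<lambda>z. g\<^sub>1 (fst z) + g\<^sub>2 (snd z))"
    using lp_duality[OF finite_cartesian_product[OF G(3) H(3)] _ W(1) dual] by blast
  obtain l where l: "l \<in> prob_weights G" "\<And>f. mean G l f = mean (G \<times> H) q (\<lambda>z. f (fst z))"
    using marginal_fst[OF q(1) G(3) H(3)] by metis
  obtain m where m: "m \<in> prob_weights H" "\<And>f. mean H m f = mean (G \<times> H) q (\<lambda>z. f (snd z))"
    using marginal_snd[OF q(1) G(3) H(3)] by metis
  have "mean G l (\<lambda>Z. indicator Z e) = mean H m (\<lambda>Z. indicator Z e)" for e
  proof (cases "e \<in> W")
    case True
    then show ?thesis using q(2)[OF True] unfolding l(2) m(2)
      by (simp add: mean_def right_diff_distrib sum_subtractf)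
  next
    case False
    then have "e \<notin> Z" if "Z \<in> G \<union> H" for Z using that G(2) H(2) by blast
    then show ?thesis unfolding l(2) m(2) unfolding mean_def
      by (intro sum.cong) (auto simp: indicator_def)
  qed
  then obtain J where J: "J \<in> G \<inter> H" "mean G l g\<^sub>1 + mean H m g\<^sub>2 \<le> g\<^sub>1 J + g\<^sub>2 J"
    using valuated_intersection_integral[OF W(1) G(2) H(2) G(1) H(1) l(1) m(1)] by blast
  have "mean (G \<times> H) q (\<lambda>z. g\<^sub>1 (fst z) + g\<^sub>2 (snd z)) = mean G l g\<^sub>1 + mean H m g\<^sub>2"
    unfolding l(2) m(2) by (simp add: mean_def distrib_left sum.distrib)
  with q(3) J(2) have "g X + g Y \<le> g ((X - I) \<union> J) + g ((Y - J) \<union> I)"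
    unfolding g\<^sub>1_def g\<^sub>2_def by linarith
  with J(1) show ?thesis by (auto simp: G_def H_def W_def D'_def)
qed

section \<open>From extended real values to real values on the domain\<close>

lemma dom_fun_finite_value:
  assumes "valued_on N f" "Z \<in> dom_fun N f"
  shows "f Z = ereal (real_of_ereal (f Z))"
  using assms unfolding valued_on_def dom_fun_def by (cases "f Z") auto

text \<open>The supremum over the partners is attained because \<open>Y - X\<close> is finite; an
  empty range would give \<open>-\<infinity>\<close>, which cannot bound the real number
  \<open>f X + f Y\<close>.\<close>

lemma exch_Mnat_concave:
  assumes "finite N" "Mnat_concave N f"
  shows "exch (dom_fun N f) (\<lambda>Z. real_of_ereal (f Z))"
  unfolding exch_def
proof (intro ballI, goal_cases)
  case (1 X Y i)
  have val: "valued_on N f" using assms(2) by (simp add: Mnat_concave_def)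
  have sub: "X \<subseteq> N" "Y \<subseteq> N" using 1 by (auto simp: dom_fun_def)
  let ?S = "(\<lambda>j. f (insert j (X - {i})) + f (insert i Y - {j})) ` (Y - X)"
  have le: "f X + f Y \<le> max (f (X - {i}) + f (insert i Y)) (Sup ?S)"
    using assms(2) sub 1(3) unfolding Mnat_concave_def by blast
  obtain a b where ab: "f X = ereal a" "f Y = ereal b"
    using dom_fun_finite_value[OF val] 1(1,2) by blast
  have "\<exists>S j. S \<subseteq> Y - X \<and> S \<subseteq> {j} \<and> f X + f Y \<le> f ((X - {i}) \<union> S) + f (insert i Y - S)"
  proof (cases "f X + f Y \<le> f (X - {i}) + f (insert i Y)")
    case True
    then show ?thesis by (intro exI[of _ "{}"]) auto
  next
    case False
    with le have le': "f X + f Y \<le> Sup ?S" by (auto simp: max_def split: if_splits)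
    have "?S \<noteq> {}"
    proof
      assume "?S = {}"
      with le' have "f X + f Y \<le> -\<infinity>" by (simp add: bot_ereal_def)
      then show False by (simp add: ab)
    qed
    moreover have "finite ?S" using assms(1) sub finite_subset by blast
    ultimately have "Sup ?S \<in> ?S" using Max_in[of ?S] Max_Sup[of ?S] by simp
    then obtain j where "j \<in> Y - X" "Sup ?S = f (insert j (X - {i})) + f (insert i Y - {j})" by auto
    with le' show ?thesis by (intro exI[of _ "{j}"] exI[of _ j]) auto
  qed
  then obtain S j where S: "S \<subseteq> Y - X" "S \<subseteq> {j}"
    "f X + f Y \<le> f ((X - {i}) \<union> S) + f (insert i Y - S)" (is "_ \<le> f ?A + f ?B") by blast
  have AB: "?A \<subseteq> N" "?B \<subseteq> N" using S(1) sub 1(3) by auto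
  then have "f ?A \<noteq> \<infinity>" "f ?B \<noteq> \<infinity>" using val by (auto simp: valued_on_def)
  moreover have "ereal a + ereal b \<le> f ?A + f ?B" using S(3) by (simp only: ab)
  \<comment> \<open>A real lower bound on the sum, together with the exclusion of
    \<open>\<infinity>\<close>, makes both values finite; this puts the new sets into the
    domain.\<close>
  ultimately have "f ?A > -\<infinity> \<and> f ?B > -\<infinity> \<and>
      a + b \<le> real_of_ereal (f ?A) + real_of_ereal (f ?B)"
    by (cases "f ?A"; cases "f ?B") simp_all
  with S(1,2) AB show ?case by (intro exI[of _ S] exI[of _ j]) (simp add: dom_fun_def ab)
qed

theorem theorem1:
  fixes N :: "'a set" and f :: "'a set \<Rightarrow> ereal"
  assumes "finite N"
    and "Mnat_concave N f"
  shows "multiple_exchange N f"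
  unfolding multiple_exchange_def
proof (intro allI impI)
  fix X Y I assume X: "X \<subseteq> N" and Y: "Y \<subseteq> N" and I: "I \<subseteq> X - Y"
  have val: "valued_on N f" using assms(2) by (simp add: Mnat_concave_def)
  let ?r = "\<lambda>Z. real_of_ereal (f Z)"
  show "\<exists>J. J \<subseteq> Y - X \<and> f X + f Y \<le> f ((X - I) \<union> J) + f ((Y - J) \<union> I)"
  proof (cases "X \<in> dom_fun N f \<and> Y \<in> dom_fun N f")
    case True
    have "dom_fun N f \<subseteq> Pow N" by (auto simp: dom_fun_def)
    then obtain J where J: "J \<subseteq> Y - X" "(X - I) \<union> J \<in> dom_fun N f" "(Y - J) \<union> I \<in> dom_fun N f"
      "?r X + ?r Y \<le> ?r ((X - I) \<union> J) + ?r ((Y - J) \<union> I)"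
      using exch_multiple_exchange[OF exch_Mnat_concave[OF assms] assms(1) _ _ _ I] True by blast
    from J(4) have "ereal (?r X) + ereal (?r Y) \<le> ereal (?r ((X - I) \<union> J)) + ereal (?r ((Y - J) \<union> I))"
      by simp
    then have "f X + f Y \<le> f ((X - I) \<union> J) + f ((Y - J) \<union> I)"
      using True J(2,3) by (simp only: dom_fun_finite_value[OF val, symmetric])
    with J(1) show ?thesis by blast
  next
    case False
    then have "f X = -\<infinity> \<or> f Y = -\<infinity>" using X Y by (auto simp: dom_fun_def)
    \<comment> \<open>In \<open>ereal\<close> the sum of \<open>-\<infinity>\<close> and
      \<open>\<infinity>\<close> is \<open>\<infinity>\<close>, so the value
      \<open>\<infinity>\<close> must be ruled out before the left-hand side collapses to
      \<open>-\<infinity>\<close>.\<close>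
    moreover have "f X \<noteq> \<infinity>" "f Y \<noteq> \<infinity>" using val X Y by (auto simp: valued_on_def)
    ultimately have bot: "f X + f Y = -\<infinity>" by auto
    show ?thesis unfolding bot by (intro exI[of _ "{}"]) simp
  qed
qed

end
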